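(* For all $p,q,r\ge 0$ with $n=p+q+r\ge 1$, $$\mathrm{P}_{p,q,r}=\Gamma^{(1)}_{p,q,r}\subseteq\mathrm{P}^{\Lambda}_{p,q,r}=\Gamma^{(0)}_{p,q,r}=\tilde{\Gamma}^{(0)}_{p,q,r},$$ $$\mathrm{P}^{\pm}_{p,q,r}=\check{\Gamma}^{(0)}_{p,q,r}\subseteq\mathrm{P}^{\pm\Lambda}_{p,q,r}=\check{\Gamma}^{(1)}_{p,q,r}=\tilde{\Gamma}^{(1)}_{p,q,r}.$$
   Context: Let $\mathbb{F}=\mathbb{R}$ or $\mathbb{F}=\mathbb{C}$, let $p,q,r\ge 0$ be integers and $n=p+q+r\ge 1$. $\mathcal{G}_{p,q,r}$ denotes the (Clifford) geometric algebra: the unital associative $\mathbb{F}$-algebra of dimension $2^n$ with identity $e$ and generators $e_1,\dots,e_n$ satisfying $e_ae_b+e_be_a=2\eta_{ab}e$, where $\eta$ is the diagonal matrix whose diagonal is $p$ times $1$, then $q$ times $-1$, then $r$ times $0$ (if $\mathbb{F}=\mathbb{R}$), or $p+q$ times $1$, then $r$ times $0$ (if $\mathbb{F}=\mathbb{C}$). A basis is given by $e_{a_1\ldots a_k}:=e_{a_1}\cdots e_{a_k}$, $a_1<\dots<a_k$, $0\le k\le n$ (the empty product being $e$); $\mathcal{G}^k_{p,q,r}$ (grade $k$) is the span of those with $k$ indices, and $\mathcal{G}^0=\mathbb{F}e$. The grade involution $U\mapsto\widehat U$ is the algebra automorphism with $\widehat{e_a}=-e_a$. $\mathcal{G}^{(k)}_{p,q,r}=\{U:\widehat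 U=(-1)^kU\}$, $k=0,1$ (even and odd subspaces). $\Lambda_r=\mathcal{G}_{0,0,r}$ is the (Grassmann) subalgebra generated by $e$ and the null generators $e_{p+q+1},\dots,e_n$ ($\Lambda_0=\mathcal{G}^0$), and $\Lambda_r^{(0)}=\Lambda_r\cap\mathcal{G}^{(0)}_{p,q,r}$. For a subset $A\subseteq\mathcal{G}_{p,q,r}$, $A^\times$ denotes the set of elements of $A$ invertible in $\mathcal{G}_{p,q,r}$. A product of subsets is the set of products of their elements. $\mathrm{Z}_{p,q,r}$ is the center of $\mathcal{G}_{p,q,r}$; it equals $\Lambda^{(0)}_r\oplus\mathcal{G}^n_{p,q,r}$ if $n$ is odd and $\Lambda^{(0)}_r$ if $n$ is even. Groups: $\mathrm{P}^{\pm}_{p,q,r}:=\mathcal{G}^{(0)\times}_{p,q,r}\cup\mathcal{G}^{(1)\times}_{p,q,r}$, $\mathrm{P}_{p,q,r}:=\mathrm{P}^{\pm}_{p,q,r}\mathrm{Z}^{\times}_{p,q,r}$, $\mathrm{P}^{\pm\Lambda}_{p,q,r}:=\mathrm{P}^{\pm}_{p,q,r}\Lambda_r^{\times}$, $\mathrm{P}^{\Lambda}_{p,q,r}:=\mathrm{P}_{p,q,r}\Lambda_r^{\times}$. For $T\in\mathcal{G}^\times_{p,q,r}$ and $U=U_0+U_1\in\mathcal{G}_{p,q,r}$ with $U_0\in\mathcal{G}^{(0)}_{p,q,r}$, $U_1\in\mathcal{G}^{(1)}_{p,q,r}$, set $\mathrm{ad}_T(U)=TUT^{-1}$ (adjoint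 representation), $\check{\mathrm{ad}}_T(U)=\widehat{T}UT^{-1}$ and $\tilde{\mathrm{ad}}_T(U)=TU_0T^{-1}+\widehat{T}U_1T^{-1}$ (two versions of the twisted adjoint representation). For $k=0,1$: $\Gamma^{(k)}_{p,q,r}:=\{T\in\mathcal{G}^\times_{p,q,r}:\mathrm{ad}_T(\mathcal{G}^{(k)}_{p,q,r})\subseteq\mathcal{G}^{(k)}_{p,q,r}\}$, $\check{\Gamma}^{(k)}_{p,q,r}:=\{T\in\mathcal{G}^\times_{p,q,r}:\check{\mathrm{ad}}_T(\mathcal{G}^{(k)}_{p,q,r})\subseteq\mathcal{G}^{(k)}_{p,q,r}\}$, $\tilde{\Gamma}^{(k)}_{p,q,r}:=\{T\in\mathcal{G}^\times_{p,q,r}:\tilde{\mathrm{ad}}_T(\mathcal{G}^{(k)}_{p,q,r})\subseteq\mathcal{G}^{(k)}_{p,q,r}\}$. *)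

theory Defs
  imports Complex_Main "HOL-Library.Set_Algebras"
begin

definition units_in :: "'a::monoid_mult set \<Rightarrow> 'a set" where
  "units_in A = {x \<in> A. \<exists>y. x * y = 1 \<and> y * x = 1}"

definition inv_elt :: "'a::monoid_mult \<Rightarrow> 'a" where
  "inv_elt x = (THE y. x * y = 1 \<and> y * x = 1)"

text \<open>The diagonals of the matrix \<open>\<eta>\<close>, indexed from 1. Over the complex numbers
  the first \<open>p + q\<close> generators all square to 1.\<close>

definition real_metric :: "nat \<Rightarrow> nat \<Rightarrow> nat \<Rightarrow> real" where
  "real_metric p q a = (if a \<le> p then 1 else if a \<le> p + q then -1 else 0)"

definition complex_metric :: "nat \<Rightarrow> nat \<Rightarrow> nat \<Rightarrow> complex" where
  "complex_metric p q a = (if a \<le> p + q then 1 else 0)"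

text \<open>The whole type \<open>'a\<close> is the algebra and \<open>1\<close> is the identity (called \<open>e\<close> in the
  mathematical literature); \<open>e 1, \<dots>, e n\<close> with \<open>n = p + q + r\<close> are the generators, and the
  values of \<open>e\<close> outside \<open>{1..n}\<close> are irrelevant. The axioms determine the algebra up to
  isomorphism: by \<open>relations\<close> the \<open>2 ^ n\<close> ordered products of distinct generators span it, so
  \<open>dimension\<close> makes them a basis. The locale leaves \<open>\<eta>\<close> free; it is meant to be used
  with \<open>real_metric p q\<close> and \<open>complex_metric p q\<close>.\<close>

locale geometric_algebra = vector_space scale
  for scale :: "'f::field \<Rightarrow> 'a::ring_1 \<Rightarrow> 'a" +
  fixes p q r :: nat
    and e :: "nat \<Rightarrow> 'a"
    and \<eta> :: "nat \<Rightarrow> 'f"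
  assumes scale_mult_left: "scale c x * y = scale c (x * y)"
    and scale_mult_right: "x * scale c y = scale c (x * y)"
    and relations: "\<lbrakk>a \<in> {1..p + q + r}; b \<in> {1..p + q + r}\<rbrakk> \<Longrightarrow>
      e a * e b + e b * e a = scale (2 * (if a = b then \<eta> a else 0)) 1"
    and generated: "span {prod_list xs |xs. set xs \<subseteq> e ` {1..p + q + r}} = UNIV"
    and dimension: "dim (UNIV :: 'a set) = 2 ^ (p + q + r)"
begin

text \<open>The unital subalgebra generated by \<open>X\<close>; the empty product contributes the identity.\<close>

definition gen_subalgebra :: "'a set \<Rightarrow> 'a set" where
  "gen_subalgebra X = span {prod_list xs |xs. set xs \<subseteq> X}"

definition algebra_automorphism :: "('a \<Rightarrow> 'a) \<Rightarrow> bool" where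
  "algebra_automorphism f \<longleftrightarrow> Vector_Spaces.linear scale scale f \<and> bij f \<and> f 1 = 1 \<and>
     (\<forall>u v. f (u * v) = f u * f v)"

text \<open>Unique because the \<open>e a\<close> generate the algebra; it exists because the elements
  \<open>- e a\<close> satisfy the same relations.\<close>

definition grade_inv :: "'a \<Rightarrow> 'a" where
  "grade_inv = (THE f. algebra_automorphism f \<and> (\<forall>a \<in> {1..p + q + r}. f (e a) = - e a))"

definition parity_part :: "nat \<Rightarrow> 'a set" where
  "parity_part k = {u. grade_inv u = (-1) ^ k * u}"

definition Lambda :: "'a set" where
  "Lambda = gen_subalgebra (e ` {p + q + 1..p + q + r})"

definition center :: "'a set" where
  "center = {z. \<forall>u. z * u = u * z}"

text \<open>Products of sets below are the elementwise products from
  \<^theory>\<open>HOL-Library.Set_Algebras\<close>.\<close>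

definition P_pm :: "'a set" where
  "P_pm = units_in (parity_part 0) \<union> units_in (parity_part 1)"

definition P :: "'a set" where
  "P = P_pm * units_in center"

definition P_pm_Lambda :: "'a set" where
  "P_pm_Lambda = P_pm * units_in Lambda"

definition P_Lambda :: "'a set" where
  "P_Lambda = P * units_in Lambda"

definition ad :: "'a \<Rightarrow> 'a \<Rightarrow> 'a" where
  "ad t u = t * u * inv_elt t"

definition ad_check :: "'a \<Rightarrow> 'a \<Rightarrow> 'a" where
  "ad_check t u = grade_inv t * u * inv_elt t"

definition ad_tilde :: "'a \<Rightarrow> 'a \<Rightarrow> 'a" where
  "ad_tilde t u = (THE v. \<exists>u0 \<in> parity_part 0. \<exists>u1 \<in> parity_part 1.
     u = u0 + u1 \<and> v = t * u0 * inv_elt t + grade_inv t * u1 * inv_elt t)"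

definition Gamma :: "nat \<Rightarrow> 'a set" where
  "Gamma k = {t \<in> units_in UNIV. ad t ` parity_part k \<subseteq> parity_part k}"

definition Gamma_check :: "nat \<Rightarrow> 'a set" where
  "Gamma_check k = {t \<in> units_in UNIV. ad_check t ` parity_part k \<subseteq> parity_part k}"

definition Gamma_tilde :: "nat \<Rightarrow> 'a set" where
  "Gamma_tilde k = {t \<in> units_in UNIV. ad_tilde t ` parity_part k \<subseteq> parity_part k}"

end

end

theory Submission imports Defs begin

text \<open>
  Write \<open>h\<close> for the grade involution. Membership of an invertible \<open>t\<close> in each of the groups
  \<open>\<Gamma>\<close> is a commutation condition on \<open>w = t\<^sup>-\<^sup>1 h(t)\<close>, which satisfies \<open>w h(w) = 1\<close>: \<open>w\<close> is
  central for \<open>Gamma 1\<close>, commutes with all even elements for \<open>Gamma 0\<close>, lies in \<open>Lambda\<close> for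
  \<open>Gamma_check 1\<close>, and is an even involution commuting with all even elements for \<open>Gamma_check 0\<close>.
  Comparing coefficients in the standard basis, \<open>Lambda\<close> consists of the \<open>x\<close> with
  \<open>x e\<^sub>a = e\<^sub>a h(x)\<close> for all \<open>a\<close>, and the centralizer of the even part is \<open>Lambda\<close> plus the
  multiples of the pseudoscalar.

  Since \<open>t (1 + w) = t + h(t)\<close> is even and \<open>t (1 - w) = t - h(t)\<close> is odd, \<open>t\<close> factors as desired
  as soon as one of \<open>1 + w\<close>, \<open>1 - w\<close> is invertible. For \<open>w\<close> in \<open>Lambda\<close> this holds because
  \<open>w\<close> is a scalar plus a nilpotent; for central \<open>w\<close> with even part \<open>w\<^sub>0\<close> it follows from
  \<open>(1 \<plusminus> w)(1 \<plusminus> h(w)) = 2 (1 \<plusminus> w\<^sub>0)\<close>, as even central elements lie in \<open>Lambda\<close>.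
  For \<open>w\<close> in the centralizer of the even part and \<open>r \<ge> 1\<close>, the pseudoscalar \<open>I\<close> squares to zero
  and is fixed up to scalars by \<open>Lambda\<close>, so \<open>1 \<plusminus> w = l (1 + b I)\<close> for one of the signs, with
  \<open>l\<close> invertible in \<open>Lambda\<close>; here \<open>1 + b I\<close> is central if \<open>n\<close> is odd and even if \<open>n\<close> is even.
\<close>

section \<open>Units and inverses in monoids and rings\<close>

lemma units_in_iff: "x \<in> units_in A \<longleftrightarrow> x \<in> A \<and> x \<in> units_in UNIV"
  by (simp add: units_in_def)

lemma inv_elt_eq:
  fixes x :: "'a::monoid_mult"
  assumes "x * y = 1" "y * x = 1" shows "inv_elt x = y"
  unfolding inv_elt_def
proof (rule the_equality)
  fix z assume z: "x * z = 1 \<and> z * x = 1"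
  have "z = z * (x * y)" using assms by simp
  also have "\<dots> = y" using z by (simp flip: mult.assoc)
  finally show "z = y" .
qed (use assms in simp)

lemma inv_elt [simp]:
  assumes "x \<in> units_in A" shows "x * inv_elt x = 1" "inv_elt x * x = 1"
  using assms inv_elt_eq unfolding units_in_def by fastforce+

lemma inv_elt_cancel:
  assumes "x \<in> units_in A"
  shows "x * (inv_elt x * y) = y" "inv_elt x * (x * y) = y"
    "y * x * inv_elt x = y" "y * inv_elt x * x = y"
  using inv_elt[OF assms] by (simp_all add: mult.assoc) (simp_all flip: mult.assoc)

text \<open>A left and a right inverse may be supplied separately, since in a monoid they
  coincide.\<close>

lemma units_inI: "x * y = 1 \<Longrightarrow> z * x = 1 \<Longrightarrow> x \<in> units_in UNIV"
  for x :: "'a::monoid_mult"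
  unfolding units_in_def
  by (metis (mono_tags, lifting) UNIV_I mem_Collect_eq mult.assoc mult_1_left mult_1_right)

lemma units_in_mult:
  assumes "x \<in> units_in UNIV" "y \<in> units_in UNIV" shows "x * y \<in> units_in UNIV"
proof (rule units_inI)
  show "x * y * (inv_elt y * inv_elt x) = 1" "inv_elt y * inv_elt x * (x * y) = 1"
    using assms by (simp_all add: mult.assoc inv_elt_cancel)
qed

lemma inv_elt_unit: "x \<in> units_in A \<Longrightarrow> inv_elt x \<in> units_in UNIV"
  by (rule units_inI[of _ x x]) simp_all

lemma one_unit: "1 \<in> units_in UNIV"
  by (rule units_inI) auto

lemma mult_left_unit_eq:
  assumes "x \<in> units_in A" "x * u = x * v" shows "u = v"
  using assms inv_elt_cancel(2) by metis

text \<open>The inverse of the product gives the right inverse \<open>y * inv_elt (x * y)\<close> of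
  \<open>x\<close>, and commutation makes \<open>inv_elt (x * y) * y\<close> a left inverse.\<close>

lemma unit_factor:
  fixes x :: "'a::monoid_mult"
  assumes "x * y \<in> units_in UNIV" "x * y = y * x" shows "x \<in> units_in UNIV"
proof (rule units_inI)
  show "x * (y * inv_elt (x * y)) = 1" using inv_elt[OF assms(1)] by (simp add: mult.assoc)
  show "inv_elt (x * y) * y * x = 1" using inv_elt[OF assms(1)] assms(2) by (simp add: mult.assoc)
qed

text \<open>The inverse is the geometric series, which stops at \<open>m ^ k\<close>; it is
  telescoped once on each side.\<close>

lemma one_minus_nilpotent_unit:
  fixes m :: "'a::ring_1"
  assumes "m ^ k = 0" shows "1 - m \<in> units_in UNIV"
proof -
  have 1: "(1 - m) * (\<Sum>i<k. m ^ i) = 1 - m ^ k" for k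
  proof (induction k)
    case (Suc k)
    then show ?case by (simp add: distrib_left left_diff_distrib[of 1 m "m ^ k"])
  qed simp
  have 2: "(\<Sum>i<k. m ^ i) * (1 - m) = 1 - m ^ k" for k
  proof (induction k)
    case (Suc k)
    then show ?case by (simp add: distrib_right right_diff_distrib[of "m ^ k" 1 m] power_commutes)
  qed simp
  show ?thesis using 1[of k] 2[of k] assms by (intro units_inI) auto
qed

text \<open>Common ground of the real and the complex case: of the metric only the zero pattern
  matters, not the signs, and characteristic 0 makes 2 invertible.\<close>

locale clifford = geometric_algebra scale p q r e \<eta>
  for scale :: "'f::field_char_0 \<Rightarrow> 'a::ring_1 \<Rightarrow> 'a" and p q r e \<eta> +
  assumes nonnull: "a \<in> {1..p + q} \<Longrightarrow> \<eta> a \<noteq> 0"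
    and null: "a \<in> {p + q + 1..p + q + r} \<Longrightarrow> \<eta> a = 0"
    and dim_pos: "p + q + r \<ge> 1"
begin

abbreviation N :: "nat set" where "N \<equiv> {1..p + q + r}"
abbreviation M :: "nat set" where "M \<equiv> {p + q + 1..p + q + r}"
abbreviation word :: "nat list \<Rightarrow> 'a" where "word xs \<equiv> prod_list (map e xs)"
definition blade :: "nat set \<Rightarrow> 'a" where "blade A = word (sorted_list_of_set A)"
text \<open>Symmetric difference with \<open>{a}\<close>: the index set of
  \<open>e a * blade A\<close>, up to a scalar that may be zero.\<close>

definition flip :: "nat \<Rightarrow> nat set \<Rightarrow> nat set" where
  "flip a A = (if a \<in> A then A - {a} else insert a A)"

lemmas scale_mult = scale_mult_left scale_mult_right

section \<open>Sign rules for products of generators\<close>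

lemma double_eq_0: assumes "x + x = (0::'a)" shows "x = 0"
proof -
  have "scale 2 x = 0"
    using assms scale_left_distrib[of 1 1 x] by simp
  then show ?thesis by simp
qed

lemma double_eq: assumes "x + x = y + (y::'a)" shows "x = y"
  using double_eq_0[of "x - y"] assms by (simp add: algebra_simps)

lemma gen_anticomm: "a \<in> N \<Longrightarrow> b \<in> N \<Longrightarrow> a \<noteq> b \<Longrightarrow> e a * e b = - (e b * e a)"
  using relations[of a b] by (simp add: eq_neg_iff_add_eq_0)

lemma gen_sq: assumes "a \<in> N" shows "e a * e a = scale (\<eta> a) 1"
proof (rule double_eq)
  show "e a * e a + e a * e a = scale (\<eta> a) 1 + scale (\<eta> a) 1"
    using relations[OF assms assms] by (simp flip: scale_left_distrib)
qed

text \<open>Each letter different from \<open>a\<close> costs one sign when \<open>e a\<close> moves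
  past it; a letter equal to \<open>a\<close> costs none.\<close>

lemma word_gen:
  "set xs \<subseteq> N \<Longrightarrow> a \<in> N \<Longrightarrow>
    word xs * e a = scale ((-1) ^ length (filter (\<lambda>x. x \<noteq> a) xs)) (e a * word xs)"
proof (induction xs)
  case (Cons x xs)
  have "word (x # xs) * e a = e x * (word xs * e a)" by (simp add: mult.assoc)
  also have "\<dots> = scale ((-1) ^ length (filter (\<lambda>x. x \<noteq> a) xs)) (e x * e a * word xs)"
    using Cons by (simp add: scale_mult mult.assoc)
  finally show ?case
    using Cons.prems gen_anticomm[of x a] by (cases "x = a") (simp_all add: mult.assoc[symmetric])
qed simp

text \<open>Anticommutation allows any reordering up to sign: the head of \<open>xs\<close> is
  located in \<open>ys\<close> and moved to the front.\<close>

lemma word_set_eq: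
  "distinct xs \<Longrightarrow> distinct ys \<Longrightarrow> set xs = set ys \<Longrightarrow> set xs \<subseteq> N \<Longrightarrow>
    \<exists>s \<in> {1, -1}. word xs = scale s (word ys)"
proof (induction xs arbitrary: ys)
  case (Cons x xs)
  obtain us vs where ys: "ys = us @ x # vs"
    using Cons.prems(3) by (metis list.set_intros(1) split_list)
  have "distinct xs" "distinct (us @ vs)" "set xs = set (us @ vs)" "set xs \<subseteq> N"
    using Cons.prems ys by auto
  then obtain s where s: "s \<in> {1, -1}" "word xs = scale s (word (us @ vs))"
    using Cons.IH by blast
  define t :: 'f where "t = (-1) ^ length (filter (\<lambda>y. y \<noteq> x) us)"
  have t: "t \<in> {1, -1}" unfolding t_def by (metis insertCI neg_one_even_power neg_one_odd_power)
  have "set us \<subseteq> N" "x \<in> N" using Cons.prems ys by auto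
  then have "word us * e x = scale t (e x * word us)" unfolding t_def by (rule word_gen)
  then have "word ys = scale t (e x * word (us @ vs))"
    by (simp add: ys scale_mult flip: mult.assoc)
  then have "e x * word (us @ vs) = scale t (word ys)" using t by auto
  then have "word (x # xs) = scale (s * t) (word ys)" using s by (simp add: scale_mult)
  moreover have "s * t \<in> {1, -1}" using s t by auto
  ultimately show ?case by blast
qed simp

lemma word_blade:
  "distinct xs \<Longrightarrow> set xs \<subseteq> N \<Longrightarrow> \<exists>s \<in> {1, -1}. word xs = scale s (blade (set xs))"
  unfolding blade_def by (rule word_set_eq) auto

lemma finite_sub_N: "A \<subseteq> N \<Longrightarrow> finite A"
  using finite_subset by blast

lemma blade_empty [simp]: "blade {} = 1"
  by (simp add: blade_def)

lemma blade_gen: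
  assumes "A \<subseteq> N" "a \<in> N"
  shows "blade A * e a = scale ((-1) ^ card (A - {a})) (e a * blade A)"
proof -
  have "length (filter (\<lambda>x. x \<noteq> a) (sorted_list_of_set A)) = card (A - {a})"
    using finite_sub_N[OF assms(1)]
    by (subst distinct_card[symmetric]) (auto intro: arg_cong[where f=card])
  then show ?thesis using word_gen[of "sorted_list_of_set A" a] assms finite_sub_N[OF assms(1)]
    by (simp add: blade_def)
qed

text \<open>If \<open>a\<close> is in \<open>A\<close>, then \<open>e a\<close> is moved to the
  front of the blade and squared; otherwise it is sorted in. Exactly when the scalar vanishes is
  recorded for the later comparison of coefficients.\<close>

lemma gen_blade:
  assumes "A \<subseteq> N" "a \<in> N"
  shows "\<exists>c. e a * blade A = scale c (blade (flip a A)) \<and> (c = 0 \<longleftrightarrow> a \<in> A \<and> \<eta> a = 0)"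
proof (cases "a \<in> A")
  case True
  have fin: "finite A" using finite_sub_N assms by auto
  let ?xs = "a # sorted_list_of_set (A - {a})"
  have "distinct ?xs" "set ?xs \<subseteq> N" using assms fin by auto
  then obtain s where s: "s \<in> {1, -1}" "word ?xs = scale s (blade (set ?xs))"
    using word_blade[of ?xs] by blast
  have "set ?xs = A" using True fin by auto
  then have "blade A = scale s (e a * blade (A - {a}))"
    using s by (auto simp: blade_def)
  then have "e a * blade A = scale (s * \<eta> a) (blade (A - {a}))"
    using gen_sq[OF assms(2)] by (simp add: scale_mult flip: mult.assoc)
  then show ?thesis using True s by (intro exI[of _ "s * \<eta> a"]) (auto simp: flip_def)
next
  case False
  have fin: "finite A" using finite_sub_N assms by auto
  let ?xs = "a # sorted_list_of_set A"
  have "distinct ?xs" "set ?xs \<subseteq> N" using assms fin False by auto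
  then obtain s where s: "s \<in> {1, -1}" "word ?xs = scale s (blade (set ?xs))"
    using word_blade[of ?xs] by blast
  then have "e a * blade A = scale s (blade (insert a A))"
    using fin by (simp add: blade_def)
  then show ?thesis using False s by (intro exI[of _ s]) (auto simp: flip_def)
qed

lemma flip_sub: "A \<subseteq> N \<Longrightarrow> a \<in> N \<Longrightarrow> flip a A \<subseteq> N"
  by (auto simp: flip_def)

lemma flip_flip [simp]: "flip a (flip a A) = A"
  by (auto simp: flip_def)

section \<open>The blades as a basis\<close>

lemma span_left_mult:
  assumes "\<And>v. v \<in> B \<Longrightarrow> x * v \<in> span C" "v \<in> span B"
  shows "x * v \<in> span C"
  using assms(2)
proof (induction rule: span_induct)
  case base
  show ?case
    by (rule subspaceI) (auto simp: distrib_left scale_mult span_zero span_add span_scale)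
next
  case (step v) then show ?case using assms by auto
qed

text \<open>The span of the blades contains 1 and is stable under left multiplication by generators,
  so it contains every word.\<close>

lemma span_blade: "span (blade ` Pow N) = UNIV"
proof -
  have w: "word xs \<in> span (blade ` Pow N)" if "set xs \<subseteq> N" for xs
    using that
  proof (induction xs)
    case Nil
    have "blade {} \<in> blade ` Pow N" by (rule imageI) simp
    then show ?case using span_base by fastforce
  next
    case (Cons a xs)
    have "e a * word xs \<in> span (blade ` Pow N)"
    proof (rule span_left_mult[where B="blade ` Pow N"])
      fix v assume "v \<in> blade ` Pow N"
      then obtain A where A: "A \<subseteq> N" "v = blade A" by auto
      obtain c where "e a * blade A = scale c (blade (flip a A))"
        using gen_blade[of A a] A Cons.prems by auto
      then show "e a * v \<in> span (blade ` Pow N)"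
        unfolding A(2)
        using flip_sub[of A a] A Cons.prems by (metis PowI imageI list.set_intros(1) span_base span_scale subset_iff)
    qed (use Cons in auto)
    then show ?case by simp
  qed
  have "{prod_list xs |xs. set xs \<subseteq> e ` N} \<subseteq> span (blade ` Pow N)"
  proof clarify
    fix xs assume "set xs \<subseteq> e ` N"
    then have "xs \<in> map e ` lists N"
      by (simp add: in_lists_conv_set subset_iff flip: lists_image)
    then show "prod_list xs \<in> span (blade ` Pow N)" using w by auto
  qed
  then have "span {prod_list xs |xs. set xs \<subseteq> e ` N} \<subseteq> span (blade ` Pow N)"
    by (rule span_minimal) auto
  then show ?thesis using generated by auto
qed

text \<open>A count: there are at most \<open>2 ^ n\<close> blades and they span a space of that
  dimension, so they are distinct and independent.\<close>

lemma blade_basis: "inj_on blade (Pow N)" "independent (blade ` Pow N)"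
proof -
  have c1: "card (blade ` Pow N) \<le> 2 ^ (p + q + r)"
    using card_image_le[of "Pow N" blade] by (simp add: card_Pow)
  obtain B where B: "B \<subseteq> blade ` Pow N" "independent B" "blade ` Pow N \<subseteq> span B"
    using maximal_independent_subset by blast
  have "span B = UNIV" using span_minimal[OF B(3)] span_blade by auto
  then have cB: "card B = 2 ^ (p + q + r)"
    using dim_eq_card[of B UNIV] B dimension by auto
  have fin: "finite (blade ` Pow N)" by simp
  have "card B \<le> card (blade ` Pow N)" using B fin by (intro card_mono)
  then have c: "card (blade ` Pow N) = 2 ^ (p + q + r)" using c1 cB by simp
  then have "B = blade ` Pow N" using B fin cB by (intro card_subset_eq) auto
  then show "independent (blade ` Pow N)" using B by simp
  show "inj_on blade (Pow N)" using c by (intro eq_card_imp_inj_on) (auto simp: card_Pow)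
qed

lemma blade_expansion: "\<exists>c. u = (\<Sum>A \<in> Pow N. scale (c A) (blade A))"
proof -
  have "u \<in> span (blade ` Pow N)" using span_blade by simp
  then obtain d where "u = (\<Sum>v \<in> blade ` Pow N. scale (d v) v)"
    by (subst (asm) span_finite) auto
  then have "u = (\<Sum>A \<in> Pow N. scale (d (blade A)) (blade A))"
    using blade_basis(1) by (simp add: sum.reindex)
  then show ?thesis by (intro exI[of _ "\<lambda>A. d (blade A)"])
qed

lemma blade_coeff_0:
  assumes "(\<Sum>A \<in> Pow N. scale (c A) (blade A)) = 0" "A \<subseteq> N"
  shows "c A = 0"
proof -
  let ?g = "the_inv_into (Pow N) blade"
  have "(\<Sum>v \<in> blade ` Pow N. scale (c (?g v)) v) = (\<Sum>A \<in> Pow N. scale (c A) (blade A))"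
    using blade_basis(1) by (simp add: sum.reindex the_inv_into_f_f cong: sum.cong_simp)
  then have "c (?g (blade A)) = 0"
    using independentD[OF blade_basis(2), of "blade ` Pow N" "\<lambda>v. c (?g v)" "blade A"] assms by auto
  then show ?thesis using blade_basis(1) assms by (simp add: the_inv_into_f_f)
qed

lemma blade_nonzero: "A \<subseteq> N \<Longrightarrow> blade A \<noteq> 0"
  using blade_basis(2) dependent_zero by (metis PowI image_eqI)

text \<open>The map \<open>L\<close> moves each blade to a multiple of another one, and injectivity
  of \<open>\<pi>\<close> excludes cancellation between different images. It is applied below to
  ordinary and twisted commutators.\<close>

lemma coeff_zero:
  assumes L: "\<And>A. A \<subseteq> N \<Longrightarrow> L (blade A) = scale (d A) (blade (\<pi> A))"
    and lin: "Vector_Spaces.linear scale scale L"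
    and \<pi>: "inj_on \<pi> (Pow N)" "\<pi> ` Pow N \<subseteq> Pow N"
    and z: "L (\<Sum>A \<in> Pow N. scale (c A) (blade A)) = 0"
    and A: "A \<subseteq> N" "d A \<noteq> 0"
  shows "c A = 0"
proof -
  interpret l: Vector_Spaces.linear scale scale L by (rule lin)
  have im: "\<pi> ` Pow N = Pow N" using \<pi> by (intro endo_inj_surj) auto
  let ?g = "the_inv_into (Pow N) \<pi>"
  have "0 = (\<Sum>A \<in> Pow N. scale (c A * d A) (blade (\<pi> A)))"
    using z L by (simp add: l.sum l.scale cong: sum.cong_simp)
  also have "\<dots> = (\<Sum>A \<in> \<pi> ` Pow N. scale (c (?g A) * d (?g A)) (blade A))"
    using \<pi> by (simp add: sum.reindex the_inv_into_f_f cong: sum.cong_simp)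
  finally have "(\<Sum>A \<in> Pow N. scale (c (?g A) * d (?g A)) (blade A)) = 0" unfolding im by simp
  then have "c (?g (\<pi> A)) * d (?g (\<pi> A)) = 0"
    using blade_coeff_0[of "\<lambda>A. c (?g A) * d (?g A)" "\<pi> A"] A(1) im by auto
  then show ?thesis using A \<pi> by (simp add: the_inv_into_f_f)
qed

subsection \<open>The grade involution\<close>

lemma algebra_induct:
  assumes "\<And>u v. Q u \<Longrightarrow> Q v \<Longrightarrow> Q (u + v)" "\<And>c u. Q u \<Longrightarrow> Q (scale c u)" "Q 1"
    and "\<And>a u. a \<in> N \<Longrightarrow> Q u \<Longrightarrow> Q (e a * u)"
  shows "Q u"
proof -
  have w: "Q (prod_list xs)" if "set xs \<subseteq> e ` N" for xs
    using that by (induction xs) (use assms in auto)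
  have "u \<in> span {prod_list xs |xs. set xs \<subseteq> e ` N}" using generated by simp
  then show ?thesis
  proof (induction rule: span_induct)
    case base
    show ?case using assms(1,2) assms(2)[OF assms(3), of 0] by (auto intro!: subspaceI)
  qed (use w in auto)
qed

lemma blade_induct:
  assumes "\<And>u v. Q u \<Longrightarrow> Q v \<Longrightarrow> Q (u + v)" "\<And>c u. Q u \<Longrightarrow> Q (scale c u)"
    and "\<And>A. A \<subseteq> N \<Longrightarrow> Q (blade A)"
  shows "Q u"
proof -
  have "u \<in> span (blade ` Pow N)" using span_blade by simp
  then show ?thesis
  proof (induction rule: span_induct)
    case base
    show ?case using assms(1,2) assms(2)[OF assms(3)[of "{}"], of 0] by (auto intro!: subspaceI)
  qed (use assms in auto)
qed

lemma card_flip: "A \<subseteq> N \<Longrightarrow> (-1 :: 'f) ^ card (flip a A) = - ((-1) ^ card A)"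
proof (cases "a \<in> A")
  case True
  assume "A \<subseteq> N"
  then show ?thesis using True finite_sub_N by (subst card.remove[of A a]) (auto simp: flip_def)
qed (auto simp: flip_def finite_sub_N)

text \<open>The map is defined on the basis by the parity of the index set. Left multiplication by a
  generator changes that parity, so \<open>g\<close> negates generators on the left;
  multiplicativity follows by induction on the first factor, and bijectivity because
  \<open>g\<close> is an involution.\<close>

lemma grade_inv_exists:
  "\<exists>g. algebra_automorphism g \<and> (\<forall>a \<in> N. g (e a) = - e a)"
proof -
  interpret vector_space_pair scale scale ..
  let ?A = "the_inv_into (Pow N) blade"
  obtain g where lin: "Vector_Spaces.linear scale scale g"
    and g: "\<forall>v \<in> blade ` Pow N. g v = scale ((-1) ^ card (?A v)) v"
    using linear_independent_extend[OF blade_basis(2), of "\<lambda>v. scale ((-1) ^ card (?A v)) v"] by blast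
  interpret l: Vector_Spaces.linear scale scale g by (rule lin)
  have gb: "g (blade A) = scale ((-1) ^ card A) (blade A)" if "A \<subseteq> N" for A
    using g that blade_basis(1) by (simp add: the_inv_into_f_f)
  have g1: "g 1 = 1" using gb[of "{}"] by simp
  have ge: "g (e a * u) = - (e a * g u)" if a: "a \<in> N" for a u
  proof (induction u rule: blade_induct)
    case (3 A)
    obtain c where "e a * blade A = scale c (blade (flip a A))" using gen_blade[OF 3 a] by auto
    then show ?case using gb[OF 3] gb[OF flip_sub[OF 3 a]]
      by (simp add: l.scale card_flip[OF 3] scale_mult mult.commute)
  qed (simp_all add: l.add l.scale distrib_left scale_mult)
  have gg: "g (e a) = - e a" if "a \<in> N" for a using ge[OF that, of 1] g1 by simp
  have gm: "g (u * v) = g u * g v" for u v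
    by (induction u rule: algebra_induct)
      (simp_all add: l.add l.scale distrib_right scale_mult g1 ge mult.assoc)
  have "g (g u) = u" for u
    by (induction u rule: algebra_induct) (simp_all add: l.add l.scale g1 ge l.neg)
  then have "bij g" by (rule involuntory_imp_bij)
  then show ?thesis using lin g1 gm gg unfolding algebra_automorphism_def by blast
qed

lemma automorphism_ext:
  assumes "algebra_automorphism g" "algebra_automorphism g'" "\<forall>a \<in> N. g (e a) = g' (e a)"
  shows "g = g'"
proof
  fix u
  interpret l: Vector_Spaces.linear scale scale g
    using assms(1) by (simp add: algebra_automorphism_def)
  interpret l': Vector_Spaces.linear scale scale g'
    using assms(2) by (simp add: algebra_automorphism_def)
  show "g u = g' u"
    by (induction u rule: algebra_induct)
      (use assms in \<open>simp_all add: l.add l.scale l'.add l'.scale algebra_automorphism_def\<close>)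
qed

notation grade_inv ("h")

lemma grade_inv_auto: "algebra_automorphism h" and h_gen: "a \<in> N \<Longrightarrow> h (e a) = - e a"
proof -
  have "\<exists>!g. algebra_automorphism g \<and> (\<forall>a \<in> N. g (e a) = - e a)"
  proof (rule ex_ex1I[OF grade_inv_exists])
    fix g g' assume "algebra_automorphism g \<and> (\<forall>a \<in> N. g (e a) = - e a)"
      "algebra_automorphism g' \<and> (\<forall>a \<in> N. g' (e a) = - e a)"
    then show "g = g'" by (intro automorphism_ext) auto
  qed
  from theI'[OF this] show "algebra_automorphism h" "a \<in> N \<Longrightarrow> h (e a) = - e a"
    unfolding grade_inv_def by auto
qed

sublocale h: Vector_Spaces.linear scale scale h
  using grade_inv_auto by (simp add: algebra_automorphism_def)

lemma h_1 [simp]: "h 1 = 1" and h_mult: "h (u * v) = h u * h v"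
  using grade_inv_auto by (simp_all add: algebra_automorphism_def)

lemma h_h [simp]: "h (h u) = u"
  by (induction u rule: algebra_induct) (simp_all add: h.add h.scale h_mult h_gen h.neg)

lemma h_blade:
  assumes "A \<subseteq> N" shows "h (blade A) = scale ((-1) ^ card A) (blade A)"
proof -
  have "h (word xs) = scale ((-1) ^ length xs) (word xs)" if "set xs \<subseteq> N" for xs
    using that by (induction xs) (simp_all add: h_mult h_gen scale_mult)
  from this[of "sorted_list_of_set A"] show ?thesis
    using assms finite_sub_N[OF assms] by (simp add: blade_def)
qed

lemma parity_0: "u \<in> parity_part 0 \<longleftrightarrow> h u = u" and parity_1: "u \<in> parity_part 1 \<longleftrightarrow> h u = - u"
  by (simp_all add: parity_part_def)

text \<open>Moving past one generator exchanges \<open>x\<close> and \<open>y\<close>, so an even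
  number of generators restores \<open>x\<close> and an odd number turns it into
  \<open>y\<close>.\<close>

lemma
  assumes "\<And>a. a \<in> N \<Longrightarrow> x * e a = e a * y" "\<And>a. a \<in> N \<Longrightarrow> y * e a = e a * x"
  shows swap_even: "h u = u \<Longrightarrow> x * u = u * x" and swap_odd: "h u = - u \<Longrightarrow> x * u = u * y"
proof -
  \<comment> \<open>\<open>u + h u\<close> and \<open>u - h u\<close> are twice the even and the odd
    part of \<open>u\<close>. The statements with \<open>x\<close> and \<open>y\<close> exchanged
    are carried along because a further generator swaps the two roles.\<close>
  have "(x * (u + h u) = (u + h u) * x \<and> x * (u - h u) = (u - h u) * y) \<and>
    (y * (u + h u) = (u + h u) * y \<and> y * (u - h u) = (u - h u) * x)" (is "?Q u") for u
  proof (induction u rule: algebra_induct)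
    case (1 u v)
    have "u + v + h (u + v) = (u + h u) + (v + h v)" "u + v - h (u + v) = (u - h u) + (v - h v)"
      by (simp_all add: h.add)
    then show ?case using 1 by (simp only: distrib_left distrib_right)
  next
    case (2 c u)
    have "scale c u + h (scale c u) = scale c (u + h u)" "scale c u - h (scale c u) = scale c (u - h u)"
      by (simp_all add: h.scale scale_right_distrib scale_right_diff_distrib)
    then show ?case using 2 by (simp only: scale_mult)
  next
    case (4 a u)
    have *: "e a * u + h (e a * u) = e a * (u - h u)" "e a * u - h (e a * u) = e a * (u + h u)"
      using 4 by (simp_all add: h_mult h_gen algebra_simps)
    have "x * (e a * v) = e a * (y * v)" "y * (e a * v) = e a * (x * v)" for v
      using assms 4 by (simp_all flip: mult.assoc)
    then show ?case unfolding * using 4 by (simp add: mult.assoc)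
  qed (simp add: mult_2 mult_2_right)
  then have Q: "?Q u" .
  show "x * u = u * x" if "h u = u"
    using conjunct1[OF conjunct1[OF Q]] unfolding that distrib_left distrib_right by (rule double_eq)
  show "x * u = u * y" if "h u = - u"
    using conjunct2[OF conjunct1[OF Q]] unfolding that diff_minus_eq_add distrib_left distrib_right
    by (rule double_eq)
qed

lemma central_iff_gens: "x \<in> center \<longleftrightarrow> (\<forall>a \<in> N. x * e a = e a * x)"
proof
  assume *: "\<forall>a \<in> N. x * e a = e a * x"
  have "x * u = u * x" for u
  proof (induction u rule: algebra_induct)
    case (4 a u)
    have "x * (e a * u) = e a * (x * u)" using * 4(1) by (simp flip: mult.assoc)
    then show ?case using 4 by (simp add: mult.assoc)
  qed (simp_all add: distrib_left distrib_right scale_mult)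
  then show "x \<in> center" by (simp add: center_def)
qed (simp add: center_def)

section \<open>Coefficient comparison: \<open>Lambda\<close> and the centralizer of the even
  part\<close>

definition flip_coeff :: "nat \<Rightarrow> nat set \<Rightarrow> 'f" where
  "flip_coeff a A = (SOME c. e a * blade A = scale c (blade (flip a A)) \<and> (c = 0 \<longleftrightarrow> a \<in> A \<and> \<eta> a = 0))"

lemma flip_coeff:
  assumes "A \<subseteq> N" "a \<in> N"
  shows "e a * blade A = scale (flip_coeff a A) (blade (flip a A))"
    and "flip_coeff a A = 0 \<longleftrightarrow> a \<in> A \<and> \<eta> a = 0"
  using someI_ex[OF gen_blade[OF assms]] unfolding flip_coeff_def by auto

lemma inj_flip: "inj_on (flip a) B"
  by (rule inj_on_inverseI[where g = "flip a"]) simp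

lemma linear_intro:
  "(\<And>u v. L (u + v) = L u + L v) \<Longrightarrow> (\<And>c u. L (scale c u) = scale c (L u)) \<Longrightarrow>
    Vector_Spaces.linear scale scale L"
  by unfold_locales

lemma blade_in_Lambda:
  assumes "A \<subseteq> M" shows "blade A \<in> Lambda"
proof -
  have "finite A" using assms finite_subset by blast
  then have "set (map e (sorted_list_of_set A)) \<subseteq> e ` M" using assms by auto
  then show ?thesis unfolding Lambda_def gen_subalgebra_def blade_def by (intro span_base) blast
qed

lemma subspace_Lambda: "subspace Lambda"
  by (simp add: Lambda_def gen_subalgebra_def)

text \<open>A null generator anticommutes with every generator, including itself because its square
  is zero.\<close>

lemma Lambda_swap:
  assumes "x \<in> Lambda" "a \<in> N" shows "x * e a = e a * h x"
  using assms(1) unfolding Lambda_def gen_subalgebra_def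
proof (induction rule: span_induct)
  case base
  show ?case
    by (rule subspaceI) (auto simp: h.add h.scale distrib_left distrib_right scale_mult)
next
  case (step x)
  then obtain xs where xs: "x = prod_list xs" "set xs \<subseteq> e ` M" by blast
  have "prod_list xs * e a = e a * h (prod_list xs)"
    using xs(2)
  proof (induction xs)
    case (Cons y ys)
    then obtain b where b: "y = e b" "b \<in> M" by auto
    then have bN: "b \<in> N" by auto
    have "y * e a = - (e a * y)"
      using gen_anticomm[OF bN assms(2)] gen_sq[OF bN] null[OF b(2)] b by (cases "a = b") auto
    then have "y * (e a * v) = - (e a * (y * v))" for v by (simp flip: mult.assoc)
    then show ?case using Cons b h_gen[OF bN] by (simp add: h_mult mult.assoc)
  qed simp
  then show ?case using xs by simp
qed

text \<open>Choose a non-null \<open>a\<close> in \<open>A\<close>. The signs from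
  \<open>blade A * e a\<close> and \<open>e a * h (blade A)\<close> have exponents
  \<open>card A - 1\<close> and \<open>card A\<close>, so the twisted commutator with
  \<open>e a\<close> doubles \<open>e a * blade A\<close> up to sign, and this product is
  nonzero.\<close>

lemma coeff_zero_nonnull:
  assumes u: "u = (\<Sum>A \<in> Pow N. scale (c A) (blade A))"
    and sw: "\<And>a. a \<in> N \<Longrightarrow> u * e a = e a * h u"
    and A: "A \<subseteq> N" "\<not> A \<subseteq> M"
  shows "c A = 0"
proof -
  obtain a where a: "a \<in> A" "a \<notin> M" "a \<in> N" using A by blast
  have "a \<in> {1..p + q}" using a by auto
  then have na: "\<eta> a \<noteq> 0" by (rule nonnull)
  let ?L = "\<lambda>u. u * e a - e a * h u"
  let ?d = "\<lambda>A. ((-1) ^ card (A - {a}) - (-1) ^ card A) * flip_coeff a A"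
  show ?thesis
  proof (rule coeff_zero[where L = ?L and d = ?d and \<pi> = "flip a"])
    show "?L (blade A) = scale (?d A) (blade (flip a A))" if "A \<subseteq> N" for A
      using that a by (simp add: blade_gen h_blade scale_mult flip_coeff scale_left_diff_distrib
          left_diff_distrib)
    show "Vector_Spaces.linear scale scale ?L"
      by (rule linear_intro)
        (simp_all add: h.add h.scale distrib_left distrib_right scale_mult scale_right_diff_distrib)
    show "?L (\<Sum>A \<in> Pow N. scale (c A) (blade A)) = 0" using sw[OF a(3)] u by simp
    have "card A = Suc (card (A - {a}))" using a A finite_sub_N by (metis card.remove)
    then show "?d A \<noteq> 0" using flip_coeff[OF A(1) a(3)] na by simp
    show "flip a ` Pow N \<subseteq> Pow N" using flip_sub a by blast
  qed (rule inj_flip, rule A)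
qed

lemma Lambda_iff: "x \<in> Lambda \<longleftrightarrow> (\<forall>a \<in> N. x * e a = e a * h x)"
proof
  assume *: "\<forall>a \<in> N. x * e a = e a * h x"
  obtain c where c: "x = (\<Sum>A \<in> Pow N. scale (c A) (blade A))" using blade_expansion by blast
  have "scale (c A) (blade A) \<in> Lambda" if "A \<in> Pow N" for A
    using coeff_zero_nonnull[OF c, of A] * that blade_in_Lambda subspace_Lambda
    by (cases "A \<subseteq> M") (auto intro: subspace_scale simp: subspace_0)
  then show "x \<in> Lambda" unfolding c by (intro subspace_sum subspace_Lambda) auto
qed (auto intro: Lambda_swap)

definition I :: 'a where "I = blade N"

text \<open>If \<open>A\<close> is neither \<open>N\<close> nor contained in \<open>M\<close>, pick
  a non-null \<open>a\<close> in \<open>A\<close> and some \<open>b\<close> outside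
  \<open>A\<close>. Then \<open>e a * e b\<close> anticommutes with \<open>blade A\<close> and their
  product is nonzero, so the coefficient at \<open>A\<close> vanishes.\<close>

lemma centralizer_even_structure:
  assumes "\<And>a b. a \<in> N \<Longrightarrow> b \<in> N \<Longrightarrow> x * (e a * e b) = e a * e b * x"
  shows "\<exists>l \<in> Lambda. \<exists>b. x = l + scale b I"
proof -
  obtain c where c: "x = (\<Sum>A \<in> Pow N. scale (c A) (blade A))" using blade_expansion by blast
  have z: "c A = 0" if A: "A \<subseteq> N" "A \<noteq> N" "\<not> A \<subseteq> M" for A
  proof -
    obtain a where a: "a \<in> A" "a \<notin> M" "a \<in> N" using A by blast
    have "a \<in> {1..p + q}" using a by auto
    then have na: "\<eta> a \<noteq> 0" by (rule nonnull)
    obtain b where b: "b \<in> N" "b \<notin> A" using A by blast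
    let ?L = "\<lambda>u. u * (e a * e b) - e a * e b * u"
    let ?d = "\<lambda>A. ((-1) ^ (card (A - {a}) + card (A - {b})) - 1) * (flip_coeff b A * flip_coeff a (flip b A))"
    show ?thesis
    proof (rule coeff_zero[where L = ?L and d = ?d and \<pi> = "\<lambda>A. flip a (flip b A)"])
      show "?L (blade A) = scale (?d A) (blade (flip a (flip b A)))" if A: "A \<subseteq> N" for A
      proof -
        have 1: "blade A * (e a * e b) =
          scale ((-1) ^ (card (A - {a}) + card (A - {b}))) (e a * e b * blade A)"
          using blade_gen[OF A a(3)] blade_gen[OF A b(1)]
          by (simp add: scale_mult power_add mult.assoc flip: mult.assoc[of "blade A"])
        have "e a * e b * blade A = scale (flip_coeff b A * flip_coeff a (flip b A)) (blade (flip a (flip b A)))"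
          using flip_coeff(1)[OF A b(1)] flip_coeff(1)[OF flip_sub[OF A b(1)] a(3)]
          by (simp add: mult.assoc scale_mult)
        then show ?thesis using 1 by (simp add: left_diff_distrib scale_left_diff_distrib)
      qed
      show "Vector_Spaces.linear scale scale ?L"
        by (rule linear_intro)
          (simp_all add: distrib_left distrib_right scale_mult scale_right_diff_distrib)
      show "?L (\<Sum>A \<in> Pow N. scale (c A) (blade A)) = 0" using assms[OF a(3) b(1)] c by simp
      have "card A = Suc (card (A - {a}))" using a A finite_sub_N by (metis card.remove)
      then show "?d A \<noteq> 0"
        using flip_coeff(2)[OF A(1) b(1)] flip_coeff(2)[OF flip_sub[OF A(1) b(1)] a(3)] b(2) na
        by simp
      show "inj_on (\<lambda>A. flip a (flip b A)) (Pow N)" by (rule inj_on_inverseI[where g = "\<lambda>A. flip b (flip a A)"]) simp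
      show "(\<lambda>A. flip a (flip b A)) ` Pow N \<subseteq> Pow N"
        using flip_sub[OF flip_sub[OF _ b(1)] a(3)] by (intro image_subsetI PowI) (meson PowD)
    qed (rule A)
  qed
  \<comment> \<open>The term at \<open>N\<close> is split off even if \<open>N = M\<close>; in that
    case \<open>I\<close> itself lies in \<open>Lambda\<close> and the representation is not
    unique.\<close>
  let ?l = "\<Sum>A \<in> Pow N - {N}. scale (c A) (blade A)"
  have "scale (c A) (blade A) \<in> Lambda" if "A \<in> Pow N - {N}" for A
    using z[of A] that blade_in_Lambda subspace_Lambda
    by (cases "A \<subseteq> M") (auto intro: subspace_scale simp: subspace_0)
  then have "?l \<in> Lambda" by (intro subspace_sum subspace_Lambda) auto
  moreover have "x = ?l + scale (c N) I"
    unfolding c I_def by (subst sum.remove[of "Pow N" N]) (simp_all add: add.commute)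
  ultimately show ?thesis by blast
qed

subsection \<open>Invertibility in the Grassmann subalgebra\<close>

abbreviation U :: "'a set" where "U \<equiv> units_in UNIV"

lemma scale_unit:
  assumes "x \<in> U" "c \<noteq> 0" shows "scale c x \<in> U"
proof (rule units_inI)
  show "scale c x * scale (inverse c) (inv_elt x) = 1" "scale (inverse c) (inv_elt x) * scale c x = 1"
    using assms by (simp_all add: scale_mult)
qed

lemma scale_power: "scale c x ^ k = scale (c ^ k) (x ^ k)"
  by (induction k) (simp_all add: scale_mult)

lemma nonzero_plus_nilpotent_unit:
  assumes "m ^ k = 0" "c \<noteq> 0" shows "scale c 1 + m \<in> U"
proof -
  have "1 - scale (- inverse c) m \<in> U"
    using assms(1) by (intro one_minus_nilpotent_unit[of _ k]) (simp only: scale_power scale_zero_right)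
  then have "scale c (1 - scale (- inverse c) m) \<in> U" using assms(2) by (rule scale_unit)
  then show ?thesis using assms(2) by (simp add: scale_right_diff_distrib scale_right_distrib)
qed

lemma gen_null:
  assumes "a \<in> M" "A \<subseteq> N"
  shows "e a * blade A = (if a \<in> A then 0 else scale (flip_coeff a A) (blade (insert a A)))"
proof -
  have "a \<in> N" using assms by auto
  from flip_coeff[OF assms(2) this] null[OF assms(1)] show ?thesis by (auto simp: flip_def)
qed

lemma gen_blade_N: assumes "a \<in> M" shows "e a * I = 0" "I * e a = 0"
proof -
  have a: "a \<in> N" using assms by auto
  show "e a * I = 0" using gen_null[OF assms, of N] a by (simp add: I_def)
  then show "I * e a = 0" using blade_gen[of N a] a by (simp add: I_def)
qed

text \<open>The \<open>k\<close>-th power of the augmentation ideal of the Grassmann algebra, given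
  by its basis of blades of degree at least \<open>k\<close>.\<close>

definition aug_power :: "nat \<Rightarrow> 'a set" where
  "aug_power k = span (blade ` {A. A \<subseteq> M \<and> k \<le> card A})"

lemma aug_power_gen:
  assumes "a \<in> M" "v \<in> aug_power k" shows "e a * v \<in> aug_power (Suc k)"
  using assms(2) unfolding aug_power_def
proof (rule span_left_mult[rotated])
  fix v assume "v \<in> blade ` {A. A \<subseteq> M \<and> k \<le> card A}"
  then obtain A where A: "A \<subseteq> M" "k \<le> card A" "v = blade A" by auto
  have AN: "A \<subseteq> N" using A(1) by auto
  have "blade (insert a A) \<in> blade ` {A. A \<subseteq> M \<and> Suc k \<le> card A}" if "a \<notin> A"
    using A assms(1) that finite_sub_N[OF AN] by (intro imageI) auto
  then show "e a * v \<in> span (blade ` {A. A \<subseteq> M \<and> Suc k \<le> card A})"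
    using gen_null[OF assms(1) AN] A(3) by (auto intro: span_scale span_base span_zero)
qed

lemma aug_power_mult:
  assumes "m \<in> aug_power 1" "v \<in> aug_power k" shows "m * v \<in> aug_power (Suc k)"
  using assms(1) unfolding aug_power_def[of 1]
proof (induction rule: span_induct)
  case base
  have "subspace (aug_power (Suc k))" by (simp add: aug_power_def)
  then show ?case
    by (auto intro!: subspaceI simp: distrib_right scale_mult subspace_0 subspace_add subspace_scale)
next
  case (step m)
  then obtain A where A: "A \<subseteq> M" "1 \<le> card A" "m = blade A" by auto
  have w: "word xs * v \<in> aug_power (k + length xs)" if "set xs \<subseteq> M" for xs
    using that by (induction xs) (simp_all add: assms(2) aug_power_gen mult.assoc)
  have "finite A" using A(1) finite_subset by blast
  then have "m * v \<in> aug_power (k + card A)"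
    using w[of "sorted_list_of_set A"] A by (simp add: blade_def)
  moreover have "aug_power (k + card A) \<subseteq> aug_power (Suc k)"
    unfolding aug_power_def using A(2) by (intro span_mono image_mono) auto
  ultimately show ?case by blast
qed

text \<open>A product of \<open>r + 1\<close> factors has degree at least \<open>r + 1\<close>, but
  \<open>M\<close> has only \<open>r\<close> elements, so no blades of that degree exist.\<close>

lemma aug_nilpotent:
  assumes "m \<in> aug_power 1" shows "m ^ Suc r = 0"
proof -
  have "m ^ Suc k \<in> aug_power (Suc k)" for k
  proof (induction k)
    case (Suc k)
    then show ?case using aug_power_mult[OF assms] by simp
  qed (use assms in simp)
  then have "m ^ Suc r \<in> aug_power (Suc r)" .
  moreover have "{A. A \<subseteq> M \<and> Suc r \<le> card A} = {}"
  proof -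
    have "card A \<le> r" if "A \<subseteq> M" for A using card_mono[OF _ that] by simp
    then show ?thesis by (auto simp: not_less_eq_eq)
  qed
  ultimately show ?thesis by (simp only: aug_power_def image_empty span_empty singleton_iff)
qed

text \<open>The last letter of a nonempty word in null generators meets \<open>I\<close>, which
  already contains that generator.\<close>

lemma aug_blade_N:
  assumes "m \<in> aug_power 1" shows "m * I = 0"
  using assms unfolding aug_power_def
proof (induction rule: span_induct)
  case base
  show ?case by (auto intro!: subspaceI simp: distrib_right scale_mult)
next
  case (step m)
  then obtain A where A: "A \<subseteq> M" "1 \<le> card A" "m = blade A" by auto
  have fin: "finite A" using A(1) finite_subset by blast
  have w: "word xs * I = 0" if "set xs \<subseteq> M" "xs \<noteq> []" for xs
    using that
  proof (induction xs)
    case (Cons x xs)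
    then show ?case using gen_blade_N(1) by (cases "xs = []") (auto simp: mult.assoc)
  qed simp
  have "sorted_list_of_set A \<noteq> []" using A(2) fin by auto
  then show ?case using w[of "sorted_list_of_set A"] fin A(1,3) by (simp add: blade_def)
qed

text \<open>The empty word is the scalar 1, and every nonempty word in null generators has positive
  degree.\<close>

lemma Lambda_decomposition:
  assumes "x \<in> Lambda" shows "\<exists>c. x - scale c 1 \<in> aug_power 1"
  using assms unfolding Lambda_def gen_subalgebra_def
proof (induction rule: span_induct)
  have s: "subspace (aug_power 1)" by (simp add: aug_power_def)
  case base
  show ?case
  proof (rule subspaceI)
    show "0 \<in> {x. \<exists>c. x - scale c 1 \<in> aug_power 1}"
      using s by (auto intro!: exI[of _ 0] simp: subspace_0)
  next
    fix x y assume "x \<in> {x. \<exists>c. x - scale c 1 \<in> aug_power 1}" "y \<in> {x. \<exists>c. x - scale c 1 \<in> aug_power 1}"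
    then obtain c d where "x - scale c 1 \<in> aug_power 1" "y - scale d 1 \<in> aug_power 1" by auto
    from subspace_add[OF s this] show "x + y \<in> {x. \<exists>c. x - scale c 1 \<in> aug_power 1}"
      by (auto intro!: exI[of _ "c + d"] simp: scale_left_distrib algebra_simps)
  next
    fix k x assume "x \<in> {x. \<exists>c. x - scale c 1 \<in> aug_power 1}"
    then obtain c where "x - scale c 1 \<in> aug_power 1" by auto
    from subspace_scale[OF s this, of k] show "scale k x \<in> {x. \<exists>c. x - scale c 1 \<in> aug_power 1}"
      by (auto intro!: exI[of _ "k * c"] simp: scale_right_diff_distrib)
  qed
next
  case (step x)
  then obtain xs where xs: "x = prod_list xs" "set xs \<subseteq> e ` M" by blast
  have s: "subspace (aug_power 1)" by (simp add: aug_power_def)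
  have "prod_list xs \<in> aug_power 0" if "set xs \<subseteq> e ` M" for xs
    using that
  proof (induction xs)
    case Nil
    have "blade {} \<in> aug_power 0" unfolding aug_power_def by (intro span_base imageI) simp
    then show ?case by simp
  next
    case (Cons y ys)
    then obtain a where "a \<in> M" "y = e a" by auto
    then have "y * prod_list ys \<in> aug_power (Suc 0)" using Cons aug_power_gen by auto
    moreover have "aug_power (Suc 0) \<subseteq> aug_power 0"
      unfolding aug_power_def by (intro span_mono image_mono) auto
    ultimately show ?case by auto
  qed note P = this
  show ?case
  proof (cases xs)
    case Nil
    then show ?thesis using s xs by (auto intro!: exI[of _ 1] simp: subspace_0)
  next
    case (Cons y ys)
    then obtain a where "a \<in> M" "y = e a" using xs by auto
    then have "x \<in> aug_power 1" using P[of ys] aug_power_gen[of a _ 0] xs Cons by auto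
    then show ?thesis by (auto intro!: exI[of _ 0])
  qed
qed

text \<open>Here \<open>c\<close> is the scalar part of \<open>x\<close>. The remainder is nilpotent
  and annihilates \<open>I\<close>, so invertibility and the action on \<open>I\<close> depend on
  scalar parts alone.\<close>

lemma Lambda_scalar_part:
  assumes "x \<in> Lambda"
  shows "\<exists>c. (\<forall>d. d + c \<noteq> 0 \<longrightarrow> scale d 1 + x \<in> U) \<and> (\<forall>d. d - c \<noteq> 0 \<longrightarrow> scale d 1 - x \<in> U) \<and>
    (r \<ge> 1 \<longrightarrow> x * I = scale c I)"
proof -
  obtain c where c: "x - scale c 1 \<in> aug_power 1" using Lambda_decomposition[OF assms] by auto
  define m where "m = x - scale c 1"
  have x: "x = scale c 1 + m" by (simp add: m_def)
  have m: "m ^ Suc r = 0" "m * I = 0" using aug_nilpotent aug_blade_N c m_def by auto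
  then have "(- m) ^ Suc r = 0" using power_minus[of m "Suc r"] by (metis mult_zero_right)
  then have "scale d 1 - x \<in> U" if "d - c \<noteq> 0" for d
  proof -
    have "scale d 1 - x = scale (d - c) 1 + (- m)" by (simp add: x scale_left_diff_distrib)
    then show ?thesis
      using nonzero_plus_nilpotent_unit[OF \<open>(- m) ^ Suc r = 0\<close> that] by (simp only:)
  qed
  moreover have "scale d 1 + x \<in> U" if "d + c \<noteq> 0" for d
  proof -
    have "scale d 1 + x = scale (d + c) 1 + m" by (simp add: x scale_left_distrib)
    then show ?thesis using nonzero_plus_nilpotent_unit[OF m(1) that] by (simp only:)
  qed
  moreover have "x * I = scale c I" using m(2) by (simp add: x distrib_right scale_mult)
  ultimately show ?thesis by blast
qed

text \<open>The scalar parts \<open>1 + c\<close> and \<open>1 - c\<close> cannot both vanish,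
  because 2 is nonzero.\<close>

lemma Lambda_unit_dichotomy:
  assumes "x \<in> Lambda" shows "1 + x \<in> U \<or> 1 - x \<in> U"
proof -
  obtain c where "\<forall>d. d + c \<noteq> 0 \<longrightarrow> scale d 1 + x \<in> U" "\<forall>d. d - c \<noteq> 0 \<longrightarrow> scale d 1 - x \<in> U"
    using Lambda_scalar_part[OF assms] by blast
  from this(1)[rule_format, of 1] this(2)[rule_format, of 1] show ?thesis
    by (cases "c = 1") auto
qed

section \<open>Commutation rules and square of the pseudoscalar\<close>

lemma blade_N_gen: "a \<in> N \<Longrightarrow> I * e a = scale ((-1) ^ (p + q + r - 1)) (e a * I)"
  using blade_gen[of N a] by (simp add: I_def)

lemma blade_N_central: "odd (p + q + r) \<Longrightarrow> I \<in> center"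
  unfolding central_iff_gens using blade_N_gen uminus_power_if[of "1::'f" "p + q + r - 1"] dim_pos
  by simp

lemma blade_N_anti: "even (p + q + r) \<Longrightarrow> a \<in> N \<Longrightarrow> I * e a = e a * (- I)"
  using blade_N_gen[of a] uminus_power_if[of "1::'f" "p + q + r - 1"] dim_pos by auto

lemma h_blade_N: "h I = (if even (p + q + r) then I else - I)"
  using h_blade[of N] by (simp add: I_def)

text \<open>One null generator is moved to the right end of the first factor, where it annihilates
  the second.\<close>

lemma blade_N_sq: assumes "r \<ge> 1" shows "I * I = 0"
proof -
  define a where "a = p + q + 1"
  have a: "a \<in> M" "a \<in> N" using assms by (auto simp: a_def)
  let ?xs = "sorted_list_of_set (N - {a}) @ [a]"
  have d: "distinct ?xs" and N: "set ?xs = N" using a by auto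
  then obtain s where s: "s \<in> {1, -1}" "word ?xs = scale s I"
    using word_blade[OF d, unfolded N] unfolding I_def by blast
  then have "I = scale s (word ?xs)" by auto
  then have "I * I = scale s (word ?xs * I)" by (metis scale_mult_left)
  also have "word ?xs * I = 0" using gen_blade_N(1)[OF a(1)] by (simp add: mult.assoc)
  finally show ?thesis by simp
qed

subsection \<open>The groups\<close>

lemma h_unit: assumes "t \<in> U" shows "h t \<in> U" "inv_elt (h t) = h (inv_elt t)"
proof -
  have "h t * h (inv_elt t) = 1" "h (inv_elt t) * h t = 1"
    using assms by (simp_all flip: h_mult)
  then show "h t \<in> U" "inv_elt (h t) = h (inv_elt t)" by (auto intro: units_inI inv_elt_eq)
qed

lemma P_pm_iff: "s \<in> P_pm \<longleftrightarrow> s \<in> U \<and> (h s = s \<or> h s = - s)"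
  unfolding P_pm_def Un_iff units_in_iff[of s "parity_part _"] parity_0 parity_1 by blast

lemma P_pm_mult: "s \<in> P_pm \<Longrightarrow> s' \<in> P_pm \<Longrightarrow> s * s' \<in> P_pm"
  by (auto simp: P_pm_iff h_mult units_in_mult)

text \<open>The inverse of a homogeneous unit has the same parity as the unit, so the two signs
  cancel.\<close>

lemma P_pm_conj:
  assumes "s \<in> P_pm" "u \<in> parity_part k" shows "s * u * inv_elt s \<in> parity_part k"
proof -
  have s: "s \<in> U" and hs: "h s = s \<or> h s = - s" using assms(1) by (auto simp: P_pm_iff)
  have "h (inv_elt s) = inv_elt s" if "h s = s" using h_unit(2)[OF s] that by simp
  moreover have "h (inv_elt s) = - inv_elt s" if "h s = - s"
  proof -
    have "inv_elt (h s) = - inv_elt s" unfolding that using s by (intro inv_elt_eq) auto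
    then show ?thesis using h_unit(2)[OF s] by simp
  qed
  moreover have "h u = u \<or> h u = - u" "h u = (-1) ^ k * u"
    using assms(2) by (cases "even k"; simp add: parity_part_def)+
  ultimately show ?thesis using hs by (auto simp: parity_part_def h_mult minus_one_power_iff)
qed

lemma conj_eq: "t \<in> U \<Longrightarrow> s * u = v * t \<Longrightarrow> s * u * inv_elt t = v"
  by (simp add: inv_elt_cancel(3))

text \<open>The element called \<open>w\<close> in the introduction; it measures how far
  \<open>t\<close> is from being even.\<close>

definition quot :: "'a \<Rightarrow> 'a" where "quot t = inv_elt t * h t"

lemma quot:
  assumes "t \<in> U"
  shows "t * quot t = h t" "quot t \<in> U"
    "quot t * h (quot t) = 1" "h (quot t) * quot t = 1"
  using assms h_unit[OF assms]
  by (simp_all add: quot_def h_mult inv_elt_cancel units_in_mult inv_elt_unit mult.assoc flip: h_unit(2))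

lemma P_pm_split:
  assumes "t \<in> U"
  shows "1 + quot t \<in> U \<Longrightarrow> t * (1 + quot t) \<in> P_pm"
    and "1 - quot t \<in> U \<Longrightarrow> t * (1 - quot t) \<in> P_pm"
  using assms by (simp_all add: P_pm_iff units_in_mult)
    (simp_all add: distrib_left right_diff_distrib quot(1)[OF assms] h.add h.diff)

text \<open>Conjugation by \<open>t\<close> and by \<open>h t\<close> agree at \<open>u\<close>, so
  their quotient commutes with \<open>u\<close>.\<close>

lemma quot_comm:
  assumes "t \<in> U" "h t * u * h (inv_elt t) = t * u * inv_elt t"
  shows "quot t * u = u * quot t"
proof -
  have "quot t * u = inv_elt t * (h t * u * h (inv_elt t)) * h t"
    using h_unit[OF assms(1)] by (simp add: quot_def inv_elt_cancel mult.assoc flip: h_unit(2)[OF assms(1)])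
  also have "\<dots> = u * quot t"
    unfolding assms(2) using assms(1) by (simp add: quot_def inv_elt_cancel mult.assoc)
  finally show ?thesis .
qed

text \<open>In the twisted conjugate \<open>h t * u * inv_elt t\<close>, applying \<open>h\<close>
  exchanges \<open>t\<close> and \<open>h t\<close>; hence the quotient turns into its image under
  \<open>h\<close> when it passes \<open>u\<close>.\<close>

lemma quot_comm_check:
  assumes "t \<in> U" "t * u * h (inv_elt t) = h t * u * inv_elt t"
  shows "quot t * u = u * h (quot t)"
proof -
  have "quot t * u = inv_elt t * (h t * u * inv_elt t) * t"
    using assms(1) by (simp add: quot_def inv_elt_cancel mult.assoc)
  also have "\<dots> = u * h (quot t)"
    unfolding assms(2)[symmetric] using assms(1) by (simp add: quot_def inv_elt_cancel mult.assoc h_mult)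
  finally show ?thesis .
qed

lemma center_inv:
  assumes "z \<in> center" "z \<in> U" shows "inv_elt z \<in> center"
  unfolding center_def
proof clarify
  fix u
  have "inv_elt z * u = inv_elt z * (u * z) * inv_elt z"
    using assms(2) by (simp add: inv_elt_cancel mult.assoc)
  also have "u * z = z * u" using assms(1) by (simp add: center_def)
  finally show "inv_elt z * u = u * inv_elt z" using assms(2) by (simp add: inv_elt_cancel)
qed

text \<open>The commutation relations that characterize \<open>Lambda\<close> pass to inverses,
  which avoids an explicit inverse.\<close>

lemma Lambda_inv:
  assumes "l \<in> Lambda" "l \<in> U" shows "inv_elt l \<in> Lambda"
  unfolding Lambda_iff
proof
  fix a assume a: "a \<in> N"
  have "inv_elt l * e a = inv_elt l * (e a * h l) * h (inv_elt l)"
    using h_unit[OF assms(2)] by (simp add: inv_elt_cancel mult.assoc flip: h_unit(2)[OF assms(2)])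
  also have "e a * h l = l * e a" using Lambda_swap[OF assms(1) a] by simp
  finally show "inv_elt l * e a = e a * h (inv_elt l)" using assms(2) by (simp add: inv_elt_cancel)
qed

lemma Lambda_1: "1 \<in> Lambda"
  by (simp add: Lambda_iff)

lemma
  assumes "l \<in> Lambda"
  shows Lambda_comm_even: "h u = u \<Longrightarrow> l * u = u * l"
    and Lambda_comm_odd: "h u = - u \<Longrightarrow> h l * u = u * l"
proof -
  have *: "l * e a = e a * h l" "h l * e a = e a * l" if a: "a \<in> N" for a
  proof -
    show 1: "l * e a = e a * h l" by (rule Lambda_swap[OF assms a])
    have "h (l * e a) = h (e a * h l)" using 1 by simp
    then show "h l * e a = e a * l" by (simp add: h_mult h_gen[OF a])
  qed
  show "h u = u \<Longrightarrow> l * u = u * l" "h u = - u \<Longrightarrow> h l * u = u * l"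
    using swap_even[of l "h l" u] swap_odd[of "h l" l u] * by blast+
qed

lemma P_intro: "s \<in> P_pm \<Longrightarrow> z \<in> center \<Longrightarrow> z \<in> U \<Longrightarrow> s * z \<in> P"
  unfolding P_def by (intro set_times_intro) (auto simp: units_in_iff[of _ center])

lemma P_elim: "t \<in> P \<Longrightarrow> \<exists>s z. t = s * z \<and> s \<in> P_pm \<and> z \<in> center \<and> z \<in> U"
  unfolding P_def by (erule set_times_elim) (use units_in_iff[of _ center] in blast)

lemma P_Lambda_intro: "t \<in> P \<Longrightarrow> l \<in> Lambda \<Longrightarrow> l \<in> U \<Longrightarrow> t * l \<in> P_Lambda"
  unfolding P_Lambda_def by (intro set_times_intro) (auto simp: units_in_iff[of _ Lambda])

lemma P_Lambda_elim: "t \<in> P_Lambda \<Longrightarrow> \<exists>s l. t = s * l \<and> s \<in> P \<and> l \<in> Lambda \<and> l \<in> U"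
  unfolding P_Lambda_def by (erule set_times_elim) (use units_in_iff[of _ Lambda] in blast)

lemma P_pm_Lambda_intro: "t \<in> P_pm \<Longrightarrow> l \<in> Lambda \<Longrightarrow> l \<in> U \<Longrightarrow> t * l \<in> P_pm_Lambda"
  unfolding P_pm_Lambda_def by (intro set_times_intro) (auto simp: units_in_iff[of _ Lambda])

lemma P_pm_Lambda_elim: "t \<in> P_pm_Lambda \<Longrightarrow> \<exists>s l. t = s * l \<and> s \<in> P_pm \<and> l \<in> Lambda \<and> l \<in> U"
  unfolding P_pm_Lambda_def by (erule set_times_elim) (use units_in_iff[of _ Lambda] in blast)

lemma P_pm_subset_P: "P_pm \<subseteq> P"
proof
  fix s assume "s \<in> P_pm"
  from P_intro[OF this, of 1] show "s \<in> P" by (simp add: center_def one_unit)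
qed

lemma P_subset_P_Lambda: "P \<subseteq> P_Lambda"
  using P_Lambda_intro[of _ 1] Lambda_1 one_unit by auto

lemma P_pm_subset_P_pm_Lambda: "P_pm \<subseteq> P_pm_Lambda"
  using P_pm_Lambda_intro[of _ 1] Lambda_1 one_unit by auto

lemma central_quot:
  assumes t: "t \<in> U" and c: "quot t \<in> center" shows "t \<in> P"
proof -
  define w where "w = quot t"
  have w: "w * u = u * w" for u using c by (simp add: w_def center_def)
  have w1: "w * h w = 1" "h w * w = 1" using quot[OF t] by (simp_all add: w_def)
  have hw: "h w * u = u * h w" for u
  proof -
    have "h (w * h u) = h (h u * w)" by (simp add: w)
    then show ?thesis by (simp add: h_mult)
  qed
  \<comment> \<open>The even part of \<open>quot t\<close>: being even and central, it satisfies the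
    criterion for \<open>Lambda\<close>.\<close>
  let ?v = "scale (1/2) (w + h w)"
  have "?v \<in> Lambda"
    unfolding Lambda_iff
    by (simp add: h.scale h.add scale_mult distrib_left distrib_right w hw add.commute)
  then have "1 + ?v \<in> U \<or> 1 - ?v \<in> U" by (rule Lambda_unit_dichotomy)
  then have "scale 2 (1 + ?v) \<in> U \<or> scale 2 (1 - ?v) \<in> U" using scale_unit[of _ 2] by auto
  moreover have two: "scale 2 1 = (1 + 1 :: 'a)" using scale_left_distrib[of 1 1 "1::'a"] by simp
  have "(1 + w) * (1 + h w) = scale 2 (1 + ?v)" "(1 - w) * (1 - h w) = scale 2 (1 - ?v)"
    by (simp_all add: scale_right_distrib scale_right_diff_distrib two algebra_simps w1)
  moreover have "(1 + w) * (1 + h w) = (1 + h w) * (1 + w)" "(1 - w) * (1 - h w) = (1 - h w) * (1 - w)"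
    by (simp_all add: algebra_simps w1)
  ultimately have "1 + w \<in> U \<or> 1 - w \<in> U" using unit_factor by metis
  \<comment> \<open>For \<open>x = 1 + w\<close> or \<open>x = 1 - w\<close> this writes
    \<open>t\<close> as \<open>t * x\<close> times the central unit
    \<open>inv_elt x\<close>.\<close>
  moreover have "t \<in> P" if "x \<in> U" "x \<in> center" "t * x \<in> P_pm" for x
    using P_intro[OF that(3) center_inv[OF that(2,1)] inv_elt_unit[OF that(1)]] that(1)
    by (simp add: inv_elt_cancel)
  moreover have "1 + w \<in> center" "1 - w \<in> center" using w by (auto simp: center_def algebra_simps)
  ultimately show ?thesis using P_pm_split[OF t] unfolding w_def by blast
qed

section \<open>Relations for \<open>quot t\<close> and the groups preserving the odd
  subspace\<close>

lemma gen_odd: "a \<in> N \<Longrightarrow> e a \<in> parity_part 1"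
  unfolding parity_1 by (rule h_gen)

lemma gen_gen_even: "a \<in> N \<Longrightarrow> b \<in> N \<Longrightarrow> e a * e b \<in> parity_part 0"
  unfolding parity_0 by (simp add: h_mult h_gen)

text \<open>\<open>u\<close> and its conjugate have the same parity, so their signs under
  \<open>h\<close> cancel.\<close>

lemma Gamma_quot:
  assumes "t \<in> Gamma k" "u \<in> parity_part k" shows "quot t * u = u * quot t"
proof (rule quot_comm)
  show t: "t \<in> U" using assms(1) by (simp add: Gamma_def)
  have "h (t * u * inv_elt t) = (-1) ^ k * (t * u * inv_elt t)"
    using assms by (auto simp: Gamma_def ad_def parity_part_def)
  moreover have "h u = (-1) ^ k * u" using assms(2) by (simp add: parity_part_def)
  ultimately show "h t * u * h (inv_elt t) = t * u * inv_elt t"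
    by (cases "even k") (simp_all add: h_mult)
qed

lemma Gamma_check_quot:
  assumes "t \<in> Gamma_check k" "u \<in> parity_part k" shows "quot t * u = u * h (quot t)"
proof (rule quot_comm_check)
  show t: "t \<in> U" using assms(1) by (simp add: Gamma_check_def)
  have "h (h t * u * inv_elt t) = (-1) ^ k * (h t * u * inv_elt t)"
    using assms by (auto simp: Gamma_check_def ad_check_def parity_part_def)
  moreover have "h u = (-1) ^ k * u" using assms(2) by (simp add: parity_part_def)
  ultimately show "t * u * h (inv_elt t) = h t * u * inv_elt t"
    by (cases "even k") (simp_all add: h_mult)
qed

text \<open>Central factors drop out of a conjugation. Conversely the generators are odd, so
  \<open>quot t\<close> commutes with all of them and is central.\<close>

lemma P_eq_Gamma_1: "P = Gamma 1"
proof
  show "P \<subseteq> Gamma 1"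
  proof
    fix t assume "t \<in> P"
    then obtain s z where t: "t = s * z" and s: "s \<in> P_pm" and z: "z \<in> center" "z \<in> U"
      using P_elim by blast
    have sU: "s \<in> U" using s by (simp add: P_pm_iff)
    have tU: "t \<in> U" using t sU z by (simp add: units_in_mult)
    have "ad t u \<in> parity_part 1" if "u \<in> parity_part 1" for u
    proof -
      have "z * u = u * z" using z by (simp add: center_def)
      then have "t * u = s * u * inv_elt s * t" using sU by (simp add: t inv_elt_cancel mult.assoc)
      then show ?thesis using conj_eq[OF tU] P_pm_conj[OF s that] by (simp add: ad_def)
    qed
    then show "t \<in> Gamma 1" using tU by (auto simp: Gamma_def)
  qed
  show "Gamma 1 \<subseteq> P"
  proof
    fix t assume t: "t \<in> Gamma 1"
    have "quot t \<in> center"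
      unfolding central_iff_gens using Gamma_quot[OF t gen_odd] by blast
    then show "t \<in> P" using central_quot t by (simp add: Gamma_def)
  qed
qed

text \<open>For odd \<open>u\<close> the relation \<open>h l * u = u * l\<close> removes the factor
  from \<open>Lambda\<close>. Conversely, testing on generators gives exactly the relations
  characterizing \<open>Lambda\<close>.\<close>

lemma P_pm_Lambda_eq_Gamma_check_1: "P_pm_Lambda = Gamma_check 1"
proof
  show "P_pm_Lambda \<subseteq> Gamma_check 1"
  proof
    fix t assume "t \<in> P_pm_Lambda"
    then obtain s l where t: "t = s * l" and s: "s \<in> P_pm" and l: "l \<in> Lambda" "l \<in> U"
      using P_pm_Lambda_elim by blast
    have sU: "s \<in> U" and hs: "h s = s \<or> h s = - s" using s by (auto simp: P_pm_iff)
    have tU: "t \<in> U" using t sU l by (simp add: units_in_mult)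
    have "ad_check t u \<in> parity_part 1" if u: "u \<in> parity_part 1" for u
    proof -
      have "h l * u = u * l" using Lambda_comm_odd[OF l(1)] u by (simp only: parity_1)
      then have "h t * u = h s * u * inv_elt s * t" using sU by (simp add: t h_mult inv_elt_cancel mult.assoc)
      then have "ad_check t u = h s * u * inv_elt s" using conj_eq[OF tU] by (simp add: ad_check_def)
      then show ?thesis using P_pm_conj[OF s u] hs by (auto simp: parity_part_def h.neg)
    qed
    then show "t \<in> Gamma_check 1" using tU by (auto simp: Gamma_check_def)
  qed
  show "Gamma_check 1 \<subseteq> P_pm_Lambda"
  proof
    fix t assume t: "t \<in> Gamma_check 1"
    then have tU: "t \<in> U" by (simp add: Gamma_check_def)
    have w: "quot t \<in> Lambda"
      unfolding Lambda_iff using Gamma_check_quot[OF t gen_odd] by blast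
    have "1 + quot t \<in> Lambda" "1 - quot t \<in> Lambda"
      using subspace_Lambda Lambda_1 w by (auto intro: subspace_add subspace_diff)
    moreover have "t \<in> P_pm_Lambda" if "x \<in> U" "x \<in> Lambda" "t * x \<in> P_pm" for x
      using P_pm_Lambda_intro[OF that(3) Lambda_inv[OF that(2,1)] inv_elt_unit[OF that(1)]] that(1)
      by (simp add: inv_elt_cancel)
    ultimately show "t \<in> P_pm_Lambda"
      using P_pm_split[OF tU] Lambda_unit_dichotomy[OF w] by blast
  qed
qed

text \<open>Even and odd parts are unique, so the description in \<open>ad_tilde\<close> has one
  value; for homogeneous \<open>u\<close> one part is 0.\<close>

lemma ad_tilde_even: "u \<in> parity_part 0 \<Longrightarrow> ad_tilde t u = ad t u"
  and ad_tilde_odd: "u \<in> parity_part 1 \<Longrightarrow> ad_tilde t u = ad_check t u"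
proof -
  have z: "0 \<in> parity_part 0" "0 \<in> parity_part 1" by (simp_all add: parity_part_def)
  have uniq: "u0 = v0 \<and> u1 = v1" if "u0 \<in> parity_part 0" "u1 \<in> parity_part 1" "v0 \<in> parity_part 0"
    "v1 \<in> parity_part 1" "u0 + u1 = v0 + v1" for u0 u1 v0 v1
  proof -
    have "h (u0 + u1) = h (v0 + v1)" using that by simp
    then have "u0 - u1 = v0 - v1" using that(1-4) unfolding parity_0 parity_1 h.add by simp
    then have "u0 + u0 = v0 + v0" using that(5) by (metis add_diff_cancel_left' add_diff_eq diff_add_cancel add.commute add.left_commute)
    then have "u0 = v0" by (rule double_eq)
    then show ?thesis using that(5) by simp
  qed
  have *: "ad_tilde t (u0 + u1) = t * u0 * inv_elt t + h t * u1 * inv_elt t"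
    if "u0 \<in> parity_part 0" "u1 \<in> parity_part 1" for u0 u1
    unfolding ad_tilde_def
  proof (rule the_equality)
    show "\<exists>v0\<in>parity_part 0. \<exists>v1\<in>parity_part 1. u0 + u1 = v0 + v1 \<and>
      t * u0 * inv_elt t + h t * u1 * inv_elt t = t * v0 * inv_elt t + h t * v1 * inv_elt t"
      using that by blast
  qed (use uniq[OF that] in blast)
  show "u \<in> parity_part 0 \<Longrightarrow> ad_tilde t u = ad t u" using *[of u 0] z by (simp add: ad_def)
  show "u \<in> parity_part 1 \<Longrightarrow> ad_tilde t u = ad_check t u" using *[of 0 u] z by (simp add: ad_check_def)
qed

lemma Gamma_0_eq_tilde: "Gamma 0 = Gamma_tilde 0"
  unfolding Gamma_def Gamma_tilde_def using ad_tilde_even by (simp cong: image_cong_simp)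

lemma Gamma_check_1_eq_tilde: "Gamma_check 1 = Gamma_tilde 1"
  unfolding Gamma_check_def Gamma_tilde_def using ad_tilde_odd by (simp cong: image_cong_simp)

section \<open>The groups preserving the even subspace\<close>

lemma Lambda_trivial:
  assumes "r = 0" "x \<in> Lambda" shows "\<exists>c. x = scale c 1"
proof -
  have "x \<in> span {1}"
    using assms(2) unfolding Lambda_def gen_subalgebra_def by (simp add: assms(1))
  then show ?thesis by (auto simp: span_singleton)
qed

text \<open>With \<open>c\<close> the scalar part of \<open>l\<close>, the sign is chosen so that
  \<open>1 + c\<close> or \<open>1 - c\<close> is nonzero. Since \<open>1 + l\<close> and
  \<open>1 - l\<close> act on \<open>I\<close> by these scalars, the pseudoscalar term can be
  divided by them and factored out.\<close>

lemma centralizer_dichotomy: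
  assumes "r \<ge> 1" "\<And>a b. a \<in> N \<Longrightarrow> b \<in> N \<Longrightarrow> x * (e a * e b) = e a * e b * x"
  shows "\<exists>s \<in> {1, -1}. \<exists>l \<in> Lambda. \<exists>b. l \<in> U \<and> 1 + s * x = l * (1 + scale b I)"
proof -
  obtain l b where l: "l \<in> Lambda" and x: "x = l + scale b I"
    using centralizer_even_structure[OF assms(2)] by blast
  obtain c where c: "\<forall>d. d + c \<noteq> 0 \<longrightarrow> scale d 1 + l \<in> U" "\<forall>d. d - c \<noteq> 0 \<longrightarrow> scale d 1 - l \<in> U"
    "l * I = scale c I"
    using Lambda_scalar_part[OF l] assms(1) by blast
  show ?thesis
  proof (cases "1 + c = 0")
    case False
    have "(1 + l) * I = scale (1 + c) I" by (simp add: distrib_right c(3) scale_left_distrib)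
    then have "1 + 1 * x = (1 + l) * (1 + scale (b / (1 + c)) I)"
      using False by (simp add: x distrib_left[of "1 + l"] scale_mult add.assoc)
    moreover have "1 + l \<in> U" using c(1)[rule_format, of 1] False by simp
    moreover have "1 + l \<in> Lambda" using l Lambda_1 subspace_Lambda by (simp add: subspace_add)
    ultimately show ?thesis by blast
  next
    case True
    then have T: "1 - c \<noteq> 0" by auto
    have "(1 - l) * I = scale (1 - c) I" by (simp add: left_diff_distrib c(3) scale_left_diff_distrib)
    then have "1 + (-1) * x = (1 - l) * (1 + scale (- b / (1 - c)) I)"
      using T by (simp add: x right_diff_distrib[of "1 - l"] scale_mult)
    moreover have "1 - l \<in> U" using c(2)[rule_format, of 1] T by simp
    moreover have "1 - l \<in> Lambda" using l Lambda_1 subspace_Lambda by (simp add: subspace_diff)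
    ultimately show ?thesis by blast
  qed
qed

lemma blade_N_unit:
  assumes "r \<ge> 1" shows "1 + scale b I \<in> U" "inv_elt (1 + scale b I) = 1 - scale b I"
proof -
  have "(1 + scale b I) * (1 - scale b I) = 1" "(1 - scale b I) * (1 + scale b I) = 1"
    by (simp_all add: algebra_simps scale_mult blade_N_sq[OF assms])
  then show "1 + scale b I \<in> U" "inv_elt (1 + scale b I) = 1 - scale b I"
    by (auto intro: units_inI inv_elt_eq)
qed

text \<open>\<open>(1 + w) * (1 - w) = 0\<close>, and whichever factor is a unit can be
  cancelled.\<close>

lemma involution_unit_sign:
  fixes w :: 'a
  assumes "w * w = 1" "1 + w \<in> U \<or> 1 - w \<in> U" shows "w = 1 \<or> w = - 1"
proof -
  have "(1 + w) * (1 - w) = (1 + w) * 0" "(1 - w) * (1 + w) = (1 - w) * 0"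
    using assms(1) by (simp_all add: algebra_simps)
  then have "1 - w = 0 \<or> 1 + w = 0" using assms(2) mult_left_unit_eq by blast
  then show ?thesis by (auto simp: eq_neg_iff_add_eq_0 add.commute)
qed

text \<open>For \<open>r = 0\<close> and \<open>n\<close> even, \<open>quot t\<close> could a priori be a multiple of the pseudoscalar.
  This is excluded because the pseudoscalar commutes with even and anticommutes with odd elements,
  which would force that multiple to be 1.\<close>

lemma even_quot:
  assumes t: "t \<in> U" and C: "\<And>a b. a \<in> N \<Longrightarrow> b \<in> N \<Longrightarrow> quot t * (e a * e b) = e a * e b * quot t"
    and even: "h (quot t) = quot t"
  shows "t \<in> P_pm"
proof -
  define w where "w = quot t"
  have ww: "w * w = 1" using quot(3)[OF t] even by (simp add: w_def)
  have hw: "h w = w" using even by (simp add: w_def)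
  have "w = 1 \<or> w = - 1"
  proof (cases "r \<ge> 1")
    case True
    then obtain s l b where "s \<in> {1, -1}" "l \<in> U" "1 + s * w = l * (1 + scale b I)"
      using centralizer_dichotomy[OF True C] unfolding w_def by blast
    then have "1 + w \<in> U \<or> 1 - w \<in> U" using units_in_mult[OF _ blade_N_unit(1)[OF True]] by auto
    then show ?thesis by (rule involution_unit_sign[OF ww])
  next
    case False
    then have r: "r = 0" by simp
    obtain l b where "l \<in> Lambda" and "w = l + scale b I"
      using centralizer_even_structure[OF C] unfolding w_def by blast
    then obtain a where w: "w = scale a 1 + scale b I" using Lambda_trivial[OF r] by blast
    have b0: "w = 1 \<or> w = - 1" if "scale b I = 0"
    proof -
      have "w \<in> Lambda" unfolding w that using Lambda_1 subspace_Lambda by (simp add: subspace_scale)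
      then show ?thesis using involution_unit_sign[OF ww] Lambda_unit_dichotomy by blast
    qed
    show ?thesis
    proof (cases "even (p + q + r)")
      case False
      \<comment> \<open>For odd \<open>n\<close> the pseudoscalar is odd, so evenness of
        \<open>w\<close> removes its term.\<close>
      then have "scale a 1 - scale b I = scale a 1 + scale b I"
        using hw h_blade_N unfolding w h.add h.scale h_1 by (simp add: scale_minus_right)
      then have "scale b I + scale b I = 0" by (simp add: algebra_simps)
      then show ?thesis using b0 double_eq_0 by blast
    next
      case True
      have an: "I * e a = e a * (- I)" "(- I) * e a = e a * I" if "a \<in> N" for a
        using blade_N_anti[OF True that] by simp_all
      \<comment> \<open>Twice the even and the odd part of \<open>t\<close>. Right multiplication by
        \<open>w\<close> fixes \<open>t0\<close> and negates \<open>t1\<close>, while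
        \<open>I\<close> commutes with \<open>t0\<close> and anticommutes with
        \<open>t1\<close>.\<close>
      define t0 t1 where "t0 = t + h t" and "t1 = t - h t"
      have p: "h t0 = t0" "h t1 = - t1" by (simp_all add: t0_def t1_def h.add h.diff)
      have I0: "I * t0 = t0 * I" by (rule swap_even[OF an p(1)])
      have I1: "I * t1 = t1 * (- I)" by (rule swap_odd[OF an p(2)])
      have tw: "t * w = h t" using quot(1)[OF t] by (simp add: w_def)
      have "h t * w = t * (w * w)" unfolding tw[symmetric] by (simp only: mult.assoc)
      then have htw: "h t * w = t" using ww by simp
      have "t0 * w = t0" "t1 * w = - t1" by (simp_all add: t0_def t1_def distrib_right left_diff_distrib tw htw)
      then have e0: "scale a t0 + scale b (I * t0) = t0" and e1: "scale a t1 - scale b (I * t1) = - t1"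
        by (simp_all add: w distrib_left scale_mult I0 I1)
      have 1: "1 \<in> N" using dim_pos by simp
      have g1: "e 1 \<noteq> 0"
        using blade_nonzero[of "{1}"] 1 by (simp add: blade_def)
      have "\<eta> 1 \<noteq> 0" using 1 r by (intro nonnull) simp
      then have canc: "x = 0" if "e 1 * x = 0" for x
      proof -
        have "e 1 * (e 1 * x) = 0" using that by simp
        then show ?thesis using gen_sq[OF 1] \<open>\<eta> 1 \<noteq> 0\<close> by (simp add: scale_mult flip: mult.assoc)
      qed
      \<comment> \<open>What \<open>w\<close> becomes after passing \<open>e 1\<close>. Cancelling
        \<open>e 1\<close> gives \<open>w' * w' = w * w\<close>, and comparing the cross terms
        forces the multiple \<open>a * b\<close> of \<open>I\<close> to vanish.\<close>
      define w' where "w' = scale a 1 - scale b I"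
      have we: "w * (e 1 * x) = e 1 * (w' * x)" for x
        using an(1)[OF 1] by (simp add: w w'_def distrib_right distrib_left left_diff_distrib
            right_diff_distrib scale_mult flip: mult.assoc)
      have "e 1 * (w' * w' - w * w) = w * w * e 1 - e 1 * (w * w)"
        using we[of w'] we[of 1] by (simp add: right_diff_distrib mult.assoc)
      then have "e 1 * (w' * w' - w * w) = 0" using ww by simp
      then have "w' * w' - w * w = 0" by (rule canc)
      then have "w' * w' = w * w" by simp
      define A B C where "A = scale a 1" and "B = scale b I" and "C = scale (a * b) I"
      have AB: "A * B = C" "B * A = C"
        unfolding A_def B_def C_def by (simp_all add: scale_mult mult.commute)
      have "(C + C) + (C + C) = (A + B) * (A + B) - (A - B) * (A - B)"
        by (simp add: distrib_left distrib_right left_diff_distrib right_diff_distrib AB)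
      also have "\<dots> = 0" using \<open>w' * w' = w * w\<close> unfolding w w'_def A_def B_def by simp
      finally have "C + C = 0" by (rule double_eq_0)
      then have "scale (a * b) I + scale (a * b) I = 0" unfolding C_def .
      then have "scale (a * b) I = 0" by (rule double_eq_0)
      then have "a = 0 \<or> scale b I = 0" by auto
      \<comment> \<open>For \<open>a = 0\<close> both relations make \<open>scale b I\<close> act as
        the identity, so \<open>scale b I = 1\<close>; but \<open>I\<close> anticommutes with
        \<open>e 1\<close>.\<close>
      moreover have False if a0: "a = 0"
      proof -
        have "scale b (I * t0) = t0" "scale b (I * t1) = t1" using e0 e1 a0 by simp_all
        then have "scale b (I * (t0 + t1)) = t0 + t1" by (simp add: distrib_left scale_right_distrib)
        moreover have "t0 + t1 = t + t" by (simp add: t0_def t1_def)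
        ultimately have "scale b (I * t) + scale b (I * t) = t + t"
          by (simp add: distrib_left scale_right_distrib)
        then have "scale b (I * t) = t" by (rule double_eq)
        then have "scale b I * t * inv_elt t = t * inv_elt t" by (simp add: scale_mult)
        then have "scale b I = 1" using t by (simp add: inv_elt_cancel)
        then have "e 1 = - e 1" using an(1)[OF 1]
          by (metis mult_1 mult_1_right mult_minus_right scale_mult_left scale_mult_right scale_minus_right)
        then show False using g1 double_eq_0[of "e 1"] by (simp add: eq_neg_iff_add_eq_0)
      qed
      ultimately show ?thesis using b0 by blast
    qed
  qed
  then show ?thesis using quot(1)[OF t] t unfolding P_pm_iff w_def by auto
qed

lemma P_pm_eq_Gamma_check_0: "P_pm = Gamma_check 0"
proof
  show "P_pm \<subseteq> Gamma_check 0"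
  proof
    fix t assume t: "t \<in> P_pm"
    have "ad_check t u \<in> parity_part 0" if "u \<in> parity_part 0" for u
      using P_pm_conj[OF t that] t by (auto simp: P_pm_iff ad_check_def parity_part_def h.neg)
    then show "t \<in> Gamma_check 0" using t by (auto simp: Gamma_check_def P_pm_iff)
  qed
  show "Gamma_check 0 \<subseteq> P_pm"
  proof
    fix t assume t: "t \<in> Gamma_check 0"
    \<comment> \<open>Testing at the even element 1 already shows that \<open>quot t\<close> is
      even.\<close>
    have "1 \<in> parity_part 0" by (simp add: parity_0)
    from Gamma_check_quot[OF t this] have hw: "h (quot t) = quot t" by simp
    have "quot t * (e a * e b) = e a * e b * quot t" if "a \<in> N" "b \<in> N" for a b
      using Gamma_check_quot[OF t gen_gen_even[OF that]] hw by simp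
    then show "t \<in> P_pm" using t hw by (intro even_quot) (auto simp: Gamma_check_def)
  qed
qed

text \<open>Central elements and \<open>Lambda\<close> both commute with even elements, so only the
  homogeneous factor acts. For the converse, null generators allow splitting off a factor from
  \<open>Lambda\<close>; without them \<open>quot t\<close> is a scalar plus a multiple of
  \<open>I\<close>, and the parity of \<open>n\<close> decides.\<close>

lemma P_Lambda_eq_Gamma_0: "P_Lambda = Gamma 0"
proof
  show "P_Lambda \<subseteq> Gamma 0"
  proof
    fix t assume "t \<in> P_Lambda"
    then obtain s z l where t: "t = s * z * l" and s: "s \<in> P_pm" and z: "z \<in> center" "z \<in> U"
      and l: "l \<in> Lambda" "l \<in> U"
      using P_Lambda_elim P_elim by metis
    have sU: "s \<in> U" using s by (simp add: P_pm_iff)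
    have tU: "t \<in> U" using t sU z l by (simp add: units_in_mult)
    have "ad t u \<in> parity_part 0" if u: "u \<in> parity_part 0" for u
    proof -
      have "l * u = u * l" using Lambda_comm_even[OF l(1)] u by (simp only: parity_0)
      then have "t * u = s * (z * u) * l" by (simp add: t mult.assoc)
      also have "z * u = u * z" using z by (simp add: center_def)
      finally have "t * u = s * u * inv_elt s * t" using sU by (simp add: t inv_elt_cancel mult.assoc)
      then show ?thesis using conj_eq[OF tU] P_pm_conj[OF s u] by (simp add: ad_def)
    qed
    then show "t \<in> Gamma 0" using tU by (auto simp: Gamma_def)
  qed
  show "Gamma 0 \<subseteq> P_Lambda"
  proof
    fix t assume tG: "t \<in> Gamma 0"
    then have t: "t \<in> U" by (simp add: Gamma_def)
    have C: "quot t * (e a * e b) = e a * e b * quot t" if "a \<in> N" "b \<in> N" for a b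
      by (rule Gamma_quot[OF tG gen_gen_even[OF that]])
    show "t \<in> P_Lambda"
    proof (cases "r \<ge> 1")
      case True
      obtain s l b where s: "s \<in> {1, -1}" and l: "l \<in> Lambda" "l \<in> U"
        and w: "1 + s * quot t = l * (1 + scale b I)"
        using centralizer_dichotomy[OF True C] by blast
      have U: "1 + s * quot t \<in> U" unfolding w by (rule units_in_mult[OF l(2) blade_N_unit(1)[OF True]])
      then have S: "t * (1 + s * quot t) \<in> P_pm" using P_pm_split[OF t] s by auto
      \<comment> \<open>The inverse of \<open>1 + scale b I\<close>: even for even \<open>n\<close>,
        central for odd \<open>n\<close>, so it joins the homogeneous or the central factor.\<close>
      let ?y = "1 - scale b I"
      have yU: "?y \<in> U" using blade_N_unit[OF True, of b] inv_elt_unit by metis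
      have "t * (1 + s * quot t) * ?y \<in> P"
      proof (cases "even (p + q + r)")
        case True
        then have "?y \<in> P_pm" using yU by (simp add: P_pm_iff h.diff h.scale h_blade_N)
        then show ?thesis using P_pm_mult[OF S] P_pm_subset_P by blast
      next
        case False
        then have "?y \<in> center"
          using blade_N_central by (auto simp: center_def left_diff_distrib right_diff_distrib scale_mult)
        then show ?thesis using P_intro[OF S _ yU] by blast
      qed
      then have "t * (1 + s * quot t) * ?y * inv_elt l \<in> P_Lambda"
        by (rule P_Lambda_intro[OF _ Lambda_inv[OF l] inv_elt_unit[OF l(2)]])
      \<comment> \<open>Hence the product above collapses to \<open>t\<close>.\<close>
      moreover have "(1 + s * quot t) * ?y = l"
        using blade_N_unit[OF True, of b] by (metis w inv_elt_cancel(3))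
      ultimately show ?thesis using l(2) by (simp add: mult.assoc)
    next
      case False
      then have r: "r = 0" by simp
      obtain l b where "l \<in> Lambda" and "quot t = l + scale b I"
        using centralizer_even_structure[OF C] by blast
      then obtain a where w: "quot t = scale a 1 + scale b I" using Lambda_trivial[OF r] by blast
      have "t \<in> P"
      proof (cases "even (p + q + r)")
        case True
        then have "h (quot t) = quot t" by (simp add: w h.add h.scale h_blade_N)
        then show ?thesis using even_quot[OF t C] P_pm_subset_P by blast
      next
        case False
        then have "quot t \<in> center"
          using blade_N_central by (auto simp: w center_def distrib_left distrib_right scale_mult)
        then show ?thesis by (rule central_quot[OF t])
      qed
      then show ?thesis using P_subset_P_Lambda by blast
    qed
  qed
qed

lemma clifford_theorem:
  "P = Gamma 1 \<and> Gamma 1 \<subseteq> P_Lambda \<and> P_Lambda = Gamma 0 \<and> Gamma 0 = Gamma_tilde 0 \<and>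
    P_pm = Gamma_check 0 \<and> Gamma_check 0 \<subseteq> P_pm_Lambda \<and> P_pm_Lambda = Gamma_check 1 \<and>
    Gamma_check 1 = Gamma_tilde 1"
  using P_eq_Gamma_1 P_subset_P_Lambda P_Lambda_eq_Gamma_0 Gamma_0_eq_tilde
    P_pm_eq_Gamma_check_0 P_pm_subset_P_pm_Lambda P_pm_Lambda_eq_Gamma_check_1 Gamma_check_1_eq_tilde
  by blast

end

section \<open>Specialization to the real and the complex metric\<close>

theorem theorem6p1:
  fixes p q r :: nat
    and scale_real :: "real \<Rightarrow> 'a::ring_1 \<Rightarrow> 'a" and e :: "nat \<Rightarrow> 'a"
    and scale_complex :: "complex \<Rightarrow> 'b::ring_1 \<Rightarrow> 'b" and f :: "nat \<Rightarrow> 'b"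
  assumes "p + q + r \<ge> 1"
  shows "(geometric_algebra scale_real p q r e (real_metric p q) \<longrightarrow>
       geometric_algebra.P scale_real p q r e = geometric_algebra.Gamma scale_real p q r e 1 \<and>
       geometric_algebra.Gamma scale_real p q r e 1 \<subseteq> geometric_algebra.P_Lambda scale_real p q r e \<and>
       geometric_algebra.P_Lambda scale_real p q r e = geometric_algebra.Gamma scale_real p q r e 0 \<and>
       geometric_algebra.Gamma scale_real p q r e 0 = geometric_algebra.Gamma_tilde scale_real p q r e 0 \<and>
       geometric_algebra.P_pm scale_real p q r e = geometric_algebra.Gamma_check scale_real p q r e 0 \<and>
       geometric_algebra.Gamma_check scale_real p q r e 0 \<subseteq> geometric_algebra.P_pm_Lambda scale_real p q r e \<and>
       geometric_algebra.P_pm_Lambda scale_real p q r e = geometric_algebra.Gamma_check scale_real p q r e 1 \<and>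
       geometric_algebra.Gamma_check scale_real p q r e 1 = geometric_algebra.Gamma_tilde scale_real p q r e 1) \<and>
     (geometric_algebra scale_complex p q r f (complex_metric p q) \<longrightarrow>
       geometric_algebra.P scale_complex p q r f = geometric_algebra.Gamma scale_complex p q r f 1 \<and>
       geometric_algebra.Gamma scale_complex p q r f 1 \<subseteq> geometric_algebra.P_Lambda scale_complex p q r f \<and>
       geometric_algebra.P_Lambda scale_complex p q r f = geometric_algebra.Gamma scale_complex p q r f 0 \<and>
       geometric_algebra.Gamma scale_complex p q r f 0 = geometric_algebra.Gamma_tilde scale_complex p q r f 0 \<and>
       geometric_algebra.P_pm scale_complex p q r f = geometric_algebra.Gamma_check scale_complex p q r f 0 \<and>
       geometric_algebra.Gamma_check scale_complex p q r f 0 \<subseteq> geometric_algebra.P_pm_Lambda scale_complex p q r f \<and>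
       geometric_algebra.P_pm_Lambda scale_complex p q r f = geometric_algebra.Gamma_check scale_complex p q r f 1 \<and>
       geometric_algebra.Gamma_check scale_complex p q r f 1 = geometric_algebra.Gamma_tilde scale_complex p q r f 1)"
proof (intro conjI[of "_ \<longrightarrow> _"] impI)
  assume "geometric_algebra scale_real p q r e (real_metric p q)"
  then interpret geometric_algebra scale_real p q r e "real_metric p q" .
  interpret clifford scale_real p q r e "real_metric p q"
    by unfold_locales (use assms in \<open>auto simp: real_metric_def\<close>)
  show "P = Gamma 1 \<and> Gamma 1 \<subseteq> P_Lambda \<and> P_Lambda = Gamma 0 \<and> Gamma 0 = Gamma_tilde 0 \<and>
      P_pm = Gamma_check 0 \<and> Gamma_check 0 \<subseteq> P_pm_Lambda \<and> P_pm_Lambda = Gamma_check 1 \<and>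
      Gamma_check 1 = Gamma_tilde 1"
    by (rule clifford_theorem)
next
  assume "geometric_algebra scale_complex p q r f (complex_metric p q)"
  then interpret geometric_algebra scale_complex p q r f "complex_metric p q" .
  interpret clifford scale_complex p q r f "complex_metric p q"
    by unfold_locales (use assms in \<open>auto simp: complex_metric_def\<close>)
  show "P = Gamma 1 \<and> Gamma 1 \<subseteq> P_Lambda \<and> P_Lambda = Gamma 0 \<and> Gamma 0 = Gamma_tilde 0 \<and>
      P_pm = Gamma_check 0 \<and> Gamma_check 0 \<subseteq> P_pm_Lambda \<and> P_pm_Lambda = Gamma_check 1 \<and>
      Gamma_check 1 = Gamma_tilde 1"
    by (rule clifford_theorem)
qed

end
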